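(* Let $M$ be an Artin monoid and $\varphi\in\mathrm{End}(M)$. The following are equivalent: (i) $\varphi$ is a contraction with respect to $d_1$; (ii) for all $u,v\in M_{\mathrm{red}}$, $\alpha(uv)=u$ implies $\alpha(\varphi(uv))=\alpha(\varphi(u))$.
   Context: Artin monoid: $M=\langle S\mid [a,b\rangle^{m_{ab}}=[b,a\rangle^{m_{ab}},\ m_{ab}\ne\infty\rangle^+$, where $S$ is a nonempty finite set, $(m_{ab})_{a,b\in S}$ is a symmetric matrix with entries in $\{1,2,\dots,\infty\}$, $m_{aa}=1$, $m_{ab}\ge2$ for $a\neq b$, and $[a,b\rangle^m=aba\cdots$ ($m$ factors). $\ell_S$ is the word length on $M$ over $S$ (well-defined since relations are homogeneous). $W=\langle S\mid (ab)^{m_{ab}}=1,\ m_{ab}\ne\infty\rangle$ is the corresponding Coxeter group with its usual length function. $M_{\mathrm{red}}$ is the set of elements of $M$ having the same length as their image in $W$. $a\preceq b$ means $b=ac$ for some $c\in M$. For $u\in M$, $\alpha(u)$ denotes the unique maximal element for $\preceq$ of $\{v\in M_{\mathrm{red}}:v\preceq u\}$; it satisfies $\alpha(uv)=\alpha(u\alpha(v))$. Greedy normal form: for $u\ne1$, the unique sequence $\iota_1(u)=(u_1,\dots,u_n)$ in $M_{\mathrm{red}}\setminus\{1\}$ with $u=u_1\cdots u_n$ and $u_i=\alpha(u_i\cdots u_n)$ for all $i$; $\iota_1(1)$ is the empty sequence. Metric: for $u\ne v$ with $\iota_1(u)=(u_1,\dots,u_n)$, $\iota_1(v)=(v_1,\dots,v_m)$,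 let $r_1(u,v)=\max\{0\le k\le\min(n,m):u_1=v_1,\dots,u_k=v_k\}$, and $r_1(u,u)=\infty$. Then $d_1(u,v)=2^{-r_1(u,v)}$ with $2^{-\infty}=0$. $\varphi$ is a contraction with respect to $d$ if $d(\varphi(u),\varphi(v))\le d(u,v)$ for all $u,v$ (constant 1 allowed). *)

theory Defs
  imports Complex_Main "HOL-Library.Extended_Nat" "HOL-Algebra.Divisibility"
begin

section \<open>Monoids and groups given by presentations\<close>

inductive_set gen_cong :: "'a set \<Rightarrow> ('a list \<times> 'a list) set \<Rightarrow> ('a list \<times> 'a list) set"
  for A :: "'a set" and R :: "('a list \<times> 'a list) set"
  where
    base: "(x, y) \<in> R \<Longrightarrow> (x, y) \<in> gen_cong A R"
  | refl: "x \<in> lists A \<Longrightarrow> (x, x) \<in> gen_cong A R"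
  | sym: "(x, y) \<in> gen_cong A R \<Longrightarrow> (y, x) \<in> gen_cong A R"
  | trans: "(x, y) \<in> gen_cong A R \<Longrightarrow> (y, z) \<in> gen_cong A R \<Longrightarrow> (x, z) \<in> gen_cong A R"
  | append: "(x, y) \<in> gen_cong A R \<Longrightarrow> (x', y') \<in> gen_cong A R \<Longrightarrow> (x @ x', y @ y') \<in> gen_cong A R"

definition list_mult :: "('b, 'c) monoid_scheme \<Rightarrow> 'b list \<Rightarrow> 'b"
  where "list_mult G us = foldr (\<otimes>\<^bsub>G\<^esub>) us \<one>\<^bsub>G\<^esub>"

definition presented_monoid :: "'a set \<Rightarrow> ('a list \<times> 'a list) set \<Rightarrow> 'a list set monoid"
  where "presented_monoid A R =
    \<lparr>carrier = lists A // gen_cong A R,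
     mult = (\<lambda>X Y. \<Union>x\<in>X. \<Union>y\<in>Y. gen_cong A R `` {x @ y}),
     one = gen_cong A R `` {[]}\<rparr>"

text \<open>In a group presentation the letter \<open>(s, True)\<close> stands for the generator \<open>s\<close> and
  \<open>(s, False)\<close> for its formal inverse; relators are words in these signed letters.\<close>

definition group_rels :: "'a set \<Rightarrow> ('a \<times> bool) list set \<Rightarrow> (('a \<times> bool) list \<times> ('a \<times> bool) list) set"
  where "group_rels S R = {([(s, e), (s, \<not> e)], []) | s e. s \<in> S} \<union> {(r, []) | r. r \<in> R}"

definition presented_group :: "'a set \<Rightarrow> ('a \<times> bool) list set \<Rightarrow> ('a \<times> bool) list set monoid"
  where "presented_group S R = presented_monoid (S \<times> UNIV) (group_rels S R)"


section \<open>Artin monoids and Coxeter groups\<close>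

locale coxeter_matrix =
  fixes S :: "'a set" and m :: "'a \<Rightarrow> 'a \<Rightarrow> enat"
  assumes finite_S: "finite S"
    and nonempty_S: "S \<noteq> {}"
    and symmetric: "a \<in> S \<Longrightarrow> b \<in> S \<Longrightarrow> m a b = m b a"
    and diagonal: "a \<in> S \<Longrightarrow> m a a = 1"
    and off_diagonal: "a \<in> S \<Longrightarrow> b \<in> S \<Longrightarrow> a \<noteq> b \<Longrightarrow> m a b \<ge> 2"

fun alt_word :: "'a \<Rightarrow> 'a \<Rightarrow> nat \<Rightarrow> 'a list"
  where
    "alt_word a b 0 = []"
  | "alt_word a b (Suc n) = a # alt_word b a n"

definition artin_rels :: "'a set \<Rightarrow> ('a \<Rightarrow> 'a \<Rightarrow> enat) \<Rightarrow> ('a list \<times> 'a list) set"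
  where "artin_rels S m =
    {(alt_word a b n, alt_word b a n) | a b n. a \<in> S \<and> b \<in> S \<and> m a b = enat n}"

definition artin_monoid :: "'a set \<Rightarrow> ('a \<Rightarrow> 'a \<Rightarrow> enat) \<Rightarrow> 'a list set monoid"
  where "artin_monoid S m = presented_monoid S (artin_rels S m)"

definition coxeter_relators :: "'a set \<Rightarrow> ('a \<Rightarrow> 'a \<Rightarrow> enat) \<Rightarrow> ('a \<times> bool) list set"
  where "coxeter_relators S m =
    {concat (replicate n [(a, True), (b, True)]) | a b n. a \<in> S \<and> b \<in> S \<and> m a b = enat n}"

definition coxeter_group :: "'a set \<Rightarrow> ('a \<Rightarrow> 'a \<Rightarrow> enat) \<Rightarrow> ('a \<times> bool) list set monoid"
  where "coxeter_group S m = presented_group S (coxeter_relators S m)"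

definition coxeter_gen :: "'a set \<Rightarrow> ('a \<Rightarrow> 'a \<Rightarrow> enat) \<Rightarrow> 'a \<Rightarrow> ('a \<times> bool) list set"
  where "coxeter_gen S m s =
    gen_cong (S \<times> UNIV) (group_rels S (coxeter_relators S m)) `` {[(s, True)]}"

definition coxeter_eval ::
    "'a set \<Rightarrow> ('a \<Rightarrow> 'a \<Rightarrow> enat) \<Rightarrow> 'a list \<Rightarrow> ('a \<times> bool) list set"
  where "coxeter_eval S m w = list_mult (coxeter_group S m) (map (coxeter_gen S m) w)"

text \<open>The Artin relations are homogeneous and hold in the Coxeter group, so that the word length
  and the value in the Coxeter group are constant on each element of the Artin monoid (a class
  of words); \<^const>\<open>the_elem\<close> picks this common value.\<close>

definition artin_length :: "'a list set \<Rightarrow> nat"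
  where "artin_length u = the_elem (length ` u)"

definition artin_to_coxeter ::
    "'a set \<Rightarrow> ('a \<Rightarrow> 'a \<Rightarrow> enat) \<Rightarrow> 'a list set \<Rightarrow> ('a \<times> bool) list set"
  where "artin_to_coxeter S m u = the_elem (coxeter_eval S m ` u)"

definition coxeter_length :: "'a set \<Rightarrow> ('a \<Rightarrow> 'a \<Rightarrow> enat) \<Rightarrow> ('a \<times> bool) list set \<Rightarrow> nat"
  where "coxeter_length S m x =
    (LEAST n. \<exists>w\<in>lists S. length w = n \<and> coxeter_eval S m w = x)"

definition M_red :: "'a set \<Rightarrow> ('a \<Rightarrow> 'a \<Rightarrow> enat) \<Rightarrow> 'a list set set"
  where "M_red S m =
    {u \<in> carrier (artin_monoid S m). artin_length u = coxeter_length S m (artin_to_coxeter S m u)}"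


section \<open>Greedy normal form and metric\<close>

definition red_divisors :: "'a set \<Rightarrow> ('a \<Rightarrow> 'a \<Rightarrow> enat) \<Rightarrow> 'a list set \<Rightarrow> 'a list set set"
  where "red_divisors S m u = {v \<in> M_red S m. v divides\<^bsub>artin_monoid S m\<^esub> u}"

definition alpha :: "'a set \<Rightarrow> ('a \<Rightarrow> 'a \<Rightarrow> enat) \<Rightarrow> 'a list set \<Rightarrow> 'a list set"
  where "alpha S m u =
    (THE v. v \<in> red_divisors S m u \<and>
       (\<forall>w\<in>red_divisors S m u. v divides\<^bsub>artin_monoid S m\<^esub> w \<longrightarrow> w = v))"

definition normal_form :: "'a set \<Rightarrow> ('a \<Rightarrow> 'a \<Rightarrow> enat) \<Rightarrow> 'a list set \<Rightarrow> 'a list set list"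
  where "normal_form S m u =
    (if u = \<one>\<^bsub>artin_monoid S m\<^esub> then []
     else THE us. set us \<subseteq> M_red S m - {\<one>\<^bsub>artin_monoid S m\<^esub>} \<and>
       u = list_mult (artin_monoid S m) us \<and>
       (\<forall>i<length us. us ! i = alpha S m (list_mult (artin_monoid S m) (drop i us))))"

definition r1 :: "'a set \<Rightarrow> ('a \<Rightarrow> 'a \<Rightarrow> enat) \<Rightarrow> 'a list set \<Rightarrow> 'a list set \<Rightarrow> enat"
  where "r1 S m u v =
    (if u = v then \<infinity>
     else let us = normal_form S m u; vs = normal_form S m v
       in enat (Max {k. k \<le> min (length us) (length vs) \<and> (\<forall>i<k. us ! i = vs ! i)}))"

definition d1 :: "'a set \<Rightarrow> ('a \<Rightarrow> 'a \<Rightarrow> enat) \<Rightarrow> 'a list set \<Rightarrow> 'a list set \<Rightarrow> real"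
  where "d1 S m u v = (case r1 S m u v of enat k \<Rightarrow> 1 / 2 ^ k | \<infinity> \<Rightarrow> 0)"


section \<open>Endomorphisms and contractions\<close>

definition monoid_End :: "('b, 'c) monoid_scheme \<Rightarrow> ('b \<Rightarrow> 'b) set"
  where "monoid_End G = {f \<in> hom G G. f \<one>\<^bsub>G\<^esub> = \<one>\<^bsub>G\<^esub>}"

definition contraction_on :: "'b set \<Rightarrow> ('b \<Rightarrow> 'b \<Rightarrow> real) \<Rightarrow> ('b \<Rightarrow> 'b) \<Rightarrow> bool"
  where "contraction_on A d f \<longleftrightarrow> (\<forall>u\<in>A. \<forall>v\<in>A. d (f u) (f v) \<le> d u v)"

end

theory Submission
  imports Defs
begin

text \<open>
Write \<open>\<alpha>(u)\<close> for the largest reduced left divisor of \<open>u\<close> and \<open>\<omega>(u)\<close> for its cofactor,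
\<open>u = \<alpha>(u) \<omega>(u)\<close>. The entries of the normal form of \<open>u\<close> are \<open>\<alpha>(u), \<alpha>(\<omega>(u)), \<alpha>(\<omega>(\<omega>(u))), \<dots>\<close>,
and it is convenient to continue this sequence by \<open>1\<close>s. If two such padded sequences agree up to
a place where one normal form has already ended, then they agree everywhere; hence
\<open>d1(u, v) \<le> 1 / 2 ^ k\<close> holds exactly if the first \<open>k\<close> padded entries agree (\<open>r1_ge_iff\<close>), and a
contraction is a map that preserves agreement of the first \<open>k\<close> entries for every \<open>k\<close>.

For \<open>u\<close> and \<open>v\<close> as in (ii), \<open>uv\<close> and \<open>u\<close> agree in the first entry, so a contraction satisfies (ii).
Conversely, (ii) and \<open>\<alpha>(xy) = \<alpha>(x \<alpha>(y))\<close> give \<open>\<alpha>(\<phi>(u)) = \<alpha>(\<phi>(\<alpha>(u)))\<close> for all \<open>u\<close>, by induction on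
the length (\<open>alpha_map_alpha\<close>). Then the first entry of \<open>z \<phi>(u)\<close> is determined by \<open>z\<close> and \<open>\<alpha>(u)\<close>,
and cancelling it leaves \<open>z' \<phi>(\<omega>(u))\<close>, where \<open>z'\<close> is again determined by \<open>z\<close> and \<open>\<alpha>(u)\<close>. An
induction on \<open>k\<close> with varying left factor \<open>z\<close> (\<open>agree_map\<close>) shows that \<open>\<phi>\<close> is a contraction.

Three facts about the Artin monoid enter: \<open>\<alpha>\<close> exists, \<open>\<alpha>(xy) = \<alpha>(x \<alpha>(y))\<close>, and left
cancellation. All of them rest on one property of reduced elements: for reduced \<open>w\<close> and \<open>x\<close>, among
the divisors \<open>y\<close> of \<open>x\<close> with \<open>wy\<close> reduced there is a largest one
(\<open>completion_maximum_exists\<close>). The resulting operation \<open>greedy w x = wy\<close> is an action wherever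
products of reduced elements are reduced (\<open>greedy_greedy\<close>). In particular it respects the defining
relations, so folding it over a word yields an invariant of the element, and this is \<open>\<alpha>\<close>. Left
cancellation follows by comparing any two words of an element through their first letters
(\<open>linked_words\<close>).

The property itself comes from the Coxeter group: two distinct left descents \<open>a\<close>, \<open>b\<close> of a reduced
word make the alternating word of length \<open>m a b\<close> a prefix of an equivalent word (\<open>two_descents\<close>),
every alternating word up to that length may be put in front of a word with two distinct left
ascents (\<open>two_ascents\<close>), and equivalent reduced words represent the same element of the Artin monoid
(\<open>Matsumoto\<close>). What has to be excluded is a collapse of the presented group, for instance that \<open>ab\<close>
has order smaller than \<open>m a b\<close>. For this the group acts linearly on real functions (the dual of the
geometric representation); the sign at \<open>s\<close> of the translate of the constant function \<open>1\<close> by \<open>w\<close>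
tells whether \<open>s\<close> is an ascent or a descent of \<open>w\<close> (\<open>ascent_pos\<close>, \<open>red_Cons_if_pos\<close>).
\<close>

section \<open>Monoids given by presentations\<close>

locale presentation =
  fixes A :: "'b set" and R :: "('b list \<times> 'b list) set"
  assumes rels_in_lists: "R \<subseteq> lists A \<times> lists A"
begin

abbreviation cls :: "'b list \<Rightarrow> 'b list set" where "cls x \<equiv> gen_cong A R `` {x}"
abbreviation PM :: "'b list set monoid" where "PM \<equiv> presented_monoid A R"

lemma gen_cong_in_lists: "(x, y) \<in> gen_cong A R \<Longrightarrow> x \<in> lists A \<and> y \<in> lists A"
proof (induction rule: gen_cong.induct)
  case (append x y x' y')
  then show ?case by (simp add: append_in_lists_conv)
qed (use rels_in_lists in auto)

lemma equiv_gen_cong: "equiv (lists A) (gen_cong A R)"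
  by (rule equivI)
    (use gen_cong_in_lists in \<open>auto intro: refl_onI symI transI gen_cong.intros\<close>)

lemma cls_eq_iff:
  assumes "x \<in> lists A" "y \<in> lists A"
  shows "cls x = cls y \<longleftrightarrow> (x, y) \<in> gen_cong A R"
  using eq_equiv_class_iff[OF equiv_gen_cong assms] .

lemma in_cls: "y \<in> cls x \<longleftrightarrow> (x, y) \<in> gen_cong A R"
  by simp

lemma cls_carrier: "x \<in> lists A \<Longrightarrow> cls x \<in> carrier PM"
  by (simp add: presented_monoid_def quotientI)

lemma carrier_cls: "u \<in> carrier PM \<Longrightarrow> \<exists>x\<in>lists A. u = cls x"
  by (auto simp: presented_monoid_def elim!: quotientE)

lemma cls_mult:
  assumes x: "x \<in> lists A" and y: "y \<in> lists A"
  shows "cls x \<otimes>\<^bsub>PM\<^esub> cls y = cls (x @ y)"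
proof -
  have "cls (x' @ y') = cls (x @ y)"
    if "(x, x') \<in> gen_cong A R" "(y, y') \<in> gen_cong A R" for x' y'
    using that gen_cong_in_lists[OF that(1)] gen_cong_in_lists[OF that(2)]
    by (subst cls_eq_iff) (auto intro: gen_cong.sym gen_cong.append)
  then have "(\<Union>x'\<in>cls x. \<Union>y'\<in>cls y. cls (x' @ y')) = (\<Union>x'\<in>cls x. \<Union>y'\<in>cls y. cls (x @ y))"
    by (intro SUP_cong) (simp_all only: in_cls)
  also have "\<dots> = cls (x @ y)"
    using gen_cong.refl[OF x] gen_cong.refl[OF y] by blast
  finally show ?thesis
    by (simp add: presented_monoid_def)
qed

lemma one_cls: "\<one>\<^bsub>PM\<^esub> = cls []"
  by (simp add: presented_monoid_def)

lemma monoid_PM: "Group.monoid PM"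
proof (rule Group.monoidI)
  fix x y z assume xyz: "x \<in> carrier PM" "y \<in> carrier PM" "z \<in> carrier PM"
  then obtain a b c where "a \<in> lists A" "b \<in> lists A" "c \<in> lists A" "x = cls a" "y = cls b" "z = cls c"
    by (meson carrier_cls)
  then show "x \<otimes>\<^bsub>PM\<^esub> y \<otimes>\<^bsub>PM\<^esub> z = x \<otimes>\<^bsub>PM\<^esub> (y \<otimes>\<^bsub>PM\<^esub> z)"
    by (simp add: cls_mult append_in_lists_conv)
next
  fix x y assume "x \<in> carrier PM" "y \<in> carrier PM"
  then obtain a b where "a \<in> lists A" "b \<in> lists A" "x = cls a" "y = cls b"
    by (meson carrier_cls)
  then show "x \<otimes>\<^bsub>PM\<^esub> y \<in> carrier PM"
    by (simp only: cls_mult) (auto intro!: cls_carrier simp: append_in_lists_conv)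
next
  show "\<one>\<^bsub>PM\<^esub> \<in> carrier PM" by (simp only: one_cls) (auto intro!: cls_carrier)
next
  fix x assume "x \<in> carrier PM"
  then obtain a where a: "a \<in> lists A" "x = cls a" by (meson carrier_cls)
  then show "\<one>\<^bsub>PM\<^esub> \<otimes>\<^bsub>PM\<^esub> x = x" "x \<otimes>\<^bsub>PM\<^esub> \<one>\<^bsub>PM\<^esub> = x"
    unfolding one_cls a by (subst cls_mult; simp)+
qed

lemma list_mult_cls:
  "set ws \<subseteq> lists A \<Longrightarrow> list_mult PM (map cls ws) = cls (concat ws)"
proof (induction ws)
  case Nil
  then show ?case by (simp add: list_mult_def one_cls)
next
  case (Cons w ws)
  then have "concat ws \<in> lists A" by (force simp: in_lists_conv_set)
  with Cons show ?case by (simp add: list_mult_def cls_mult)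
qed

end

section \<open>Alternating words and Chebyshev recurrences\<close>

lemma length_alt_word [simp]: "length (alt_word a b n) = n"
  by (induction a b n rule: alt_word.induct) auto

lemma alt_word_lists: "a \<in> A \<Longrightarrow> b \<in> A \<Longrightarrow> alt_word a b n \<in> lists A"
  by (induction a b n rule: alt_word.induct) auto

text \<open>The alternating word \<open>abab\<dots>\<close> of length \<open>2n\<close>, cut in the middle. It turns the relators of the
  Coxeter group into the braid relations.\<close>
lemma alt_word_append_rev: "alt_word a b n @ rev (alt_word b a n) = concat (replicate n [a, b])"
proof (induction n arbitrary: a b)
  case (Suc n)
  have "alt_word a b (Suc n) @ rev (alt_word b a (Suc n))
      = a # (alt_word b a n @ rev (alt_word a b n)) @ [b]"
    by simp
  also have "\<dots> = a # concat (replicate n [b, a]) @ [b]"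
    by (simp only: Suc.IH)
  also have "\<dots> = concat (replicate (Suc n) [a, b])"
    by (induction n) auto
  finally show ?case .
qed auto

lemma take_alt_word: "i \<le> k \<Longrightarrow> take i (alt_word a b k) = alt_word a b i"
proof (induction i arbitrary: a b k)
  case (Suc i)
  then obtain k' where "k = Suc k'" "i \<le> k'" by (metis Suc_le_D Suc_le_mono)
  with Suc show ?case by simp
qed simp

lemma alt_word_snoc: "alt_word a b (Suc n) = alt_word a b n @ [if even n then a else b]"
  by (induction n arbitrary: a b) auto

lemma rev_alt_word: "rev (alt_word a b n) = (if odd n then alt_word a b n else alt_word b a n)"
proof (induction n)
  case (Suc n)
  have "rev (alt_word a b (Suc n)) = (if even n then a else b) # rev (alt_word a b n)"
    by (simp only: alt_word_snoc) simp
  then show ?case by (simp only: Suc.IH) simp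
qed simp

text \<open>The values \<open>U k = sin (k x) / sin x\<close> for \<open>c = 2 cos x\<close>, including the limit \<open>U k = k\<close> for \<open>c = 2\<close>, so
  that finite and infinite entries of the matrix can be treated alike.\<close>
fun cheb :: "real \<Rightarrow> nat \<Rightarrow> real" where
  "cheb c 0 = 0"
| "cheb c (Suc 0) = 1"
| "cheb c (Suc (Suc k)) = c * cheb c (Suc k) - cheb c k"

text \<open>The recurrence has determinant \<open>1\<close>; this is the quadratic form that it preserves.\<close>
lemma cheb_invariant: "(cheb c (Suc k))\<^sup>2 - c * cheb c (Suc k) * cheb c k + (cheb c k)\<^sup>2 = 1"
proof (induction k)
  case (Suc k)
  then show ?case by (simp add: power2_eq_square algebra_simps)
qed simp

lemma cheb_sin: "sin x * cheb (2 * cos x) k = sin (real k * x)"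
proof (induction "2 * cos x" k rule: cheb.induct)
  case (3 k)
  have "sin (real (Suc (Suc k)) * x) + sin (real k * x)
      = sin (real (Suc k) * x + x) + sin (real (Suc k) * x - x)"
    by (simp add: algebra_simps)
  also have "\<dots> = 2 * cos x * sin (real (Suc k) * x)"
    by (simp only: sin_add sin_diff) simp
  finally show ?case using 3 by (simp add: algebra_simps)
qed auto

lemma cheb_2: "cheb 2 k = real k"
  by (induction "2 :: real" k rule: cheb.induct) auto

context coxeter_matrix
begin

section \<open>The Coxeter and Artin congruences on words\<close>

sublocale artin: presentation S "artin_rels S m"
  by unfold_locales (auto simp: artin_rels_def intro: alt_word_lists[THEN in_lists_conv_set[THEN iffD1, rule_format]])

abbreviation cox_rels where "cox_rels \<equiv> group_rels S (coxeter_relators S m)"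

sublocale cox: presentation "S \<times> UNIV" cox_rels
  by unfold_locales (auto simp: group_rels_def coxeter_relators_def split: if_splits)

definition eqA :: "'a list \<Rightarrow> 'a list \<Rightarrow> bool" (infix "\<simeq>" 50)
  where "x \<simeq> y \<longleftrightarrow> (x, y) \<in> gen_cong S (artin_rels S m)"

text \<open>Group presentations use signed letters. Since each generator is its own inverse, words without
  inverses suffice to describe the Coxeter group.\<close>
definition eqW :: "'a list \<Rightarrow> 'a list \<Rightarrow> bool" (infix "\<approx>" 50)
  where "x \<approx> y \<longleftrightarrow> (map (\<lambda>s. (s, True)) x, map (\<lambda>s. (s, True)) y) \<in> gen_cong (S \<times> UNIV) cox_rels"

lemma eqW_lists: assumes "x \<approx> y" shows "x \<in> lists S" "y \<in> lists S"
  using cox.gen_cong_in_lists[OF assms[unfolded eqW_def]] by auto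

lemma eqW_refl: "x \<in> lists S \<Longrightarrow> x \<approx> x"
  unfolding eqW_def by (rule gen_cong.refl) auto

lemma eqW_sym: "x \<approx> y \<Longrightarrow> y \<approx> x"
  unfolding eqW_def by (rule gen_cong.sym)

lemma eqW_trans [trans]: "x \<approx> y \<Longrightarrow> y \<approx> z \<Longrightarrow> x \<approx> z"
  unfolding eqW_def by (rule gen_cong.trans)

lemma eqW_append: "x \<approx> y \<Longrightarrow> x' \<approx> y' \<Longrightarrow> x @ x' \<approx> y @ y'"
  unfolding eqW_def by (simp add: gen_cong.append)

lemma eqW_appL: "x \<approx> y \<Longrightarrow> z \<in> lists S \<Longrightarrow> z @ x \<approx> z @ y"
  and eqW_appR: "x \<approx> y \<Longrightarrow> z \<in> lists S \<Longrightarrow> x @ z \<approx> y @ z"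
  by (auto intro: eqW_append eqW_refl)

lemma eqW_Cons: "x \<approx> y \<Longrightarrow> s \<in> S \<Longrightarrow> s # x \<approx> s # y"
  using eqW_appL[of x y "[s]"] by simp

lemma eqW_relator: assumes "a \<in> S" "b \<in> S" "m a b = enat n"
  shows "concat (replicate n [a, b]) \<approx> []"
proof -
  have "map (\<lambda>s. (s, True)) (concat (replicate n [a, b]))
      = concat (replicate n [(a, True), (b, True)])"
    by (induction n) auto
  then show ?thesis
    using assms unfolding eqW_def
    by (intro gen_cong.base) (auto simp: group_rels_def coxeter_relators_def)
qed

lemma eqW_square: assumes "a \<in> S" shows "[a, a] \<approx> []"
  using eqW_relator[of a a 1] assms diagonal by (simp add: one_enat_def)

lemma eqW_cancel_head: assumes "a \<in> S" "x \<in> lists S" shows "a # a # x \<approx> x"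
  using eqW_appR[OF eqW_square] assms by fastforce

lemma rev_in_lists [simp]: "rev x \<in> lists S \<longleftrightarrow> x \<in> lists S"
  by (simp add: in_lists_conv_set)

lemma eqW_rev_left: "x \<in> lists S \<Longrightarrow> rev x @ x \<approx> []"
proof (induction x)
  case (Cons a x)
  then have "rev x @ (a # a # x) \<approx> rev x @ x"
    by (intro eqW_appL eqW_cancel_head) auto
  with Cons show ?case using eqW_trans by fastforce
qed (simp add: eqW_refl)

lemma eqW_rev_right: "x \<in> lists S \<Longrightarrow> x @ rev x \<approx> []"
  using eqW_rev_left[of "rev x"] by simp

lemma eqW_cancel_left: assumes "z @ x \<approx> z @ y" shows "x \<approx> y"
proof -
  have l: "z \<in> lists S" "x \<in> lists S" "y \<in> lists S"
    using eqW_lists[OF assms] by simp_all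
  have e: "(rev z @ z) @ v \<approx> v" if "v \<in> lists S" for v
    using eqW_appR[OF eqW_rev_left[OF l(1)] that] by simp
  have "x \<approx> (rev z @ z) @ x" using eqW_sym[OF e] l by blast
  also have "(rev z @ z) @ x \<approx> (rev z @ z) @ y" using eqW_appL[OF assms, of "rev z"] l by simp
  also have "\<dots> \<approx> y" using e l by blast
  finally show ?thesis .
qed

lemma eqW_rev: assumes "x \<approx> y" shows "rev x \<approx> rev y"
proof -
  have l: "x \<in> lists S" "y \<in> lists S" using eqW_lists assms by auto
  have "x @ rev x \<approx> []" using eqW_rev_right l by blast
  also have "[] \<approx> y @ rev y" using eqW_sym[OF eqW_rev_right] l by blast
  also have "y @ rev y \<approx> x @ rev y" using eqW_appR[OF eqW_sym[OF assms], of "rev y"] l by simp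
  finally show ?thesis by (rule eqW_cancel_left)
qed

text \<open>Since \<open>x x\<^sup>-\<^sup>1 = 1\<close> for words is \<open>x @ rev x \<approx> []\<close>, the relator \<open>(ab)\<^sup>n\<close> says that \<open>alt_word a b n\<close> and
  \<open>alt_word b a n\<close> have equal reversals.\<close>
lemma eqW_braid: assumes "a \<in> S" "b \<in> S" "m a b = enat n"
  shows "alt_word a b n \<approx> alt_word b a n"
proof -
  have l: "alt_word a b n \<in> lists S" "alt_word b a n \<in> lists S"
    using assms by (simp_all add: alt_word_lists)
  have "alt_word a b n @ rev (alt_word b a n) \<approx> []"
    using eqW_relator assms by (simp add: alt_word_append_rev)
  also have "[] \<approx> alt_word b a n @ rev (alt_word b a n)" using eqW_sym[OF eqW_rev_right] l by blast
  finally have "rev (alt_word a b n @ rev (alt_word b a n)) \<approx> rev (alt_word b a n @ rev (alt_word b a n))"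
    by (rule eqW_rev)
  then have "alt_word b a n @ rev (alt_word a b n) \<approx> alt_word b a n @ rev (alt_word b a n)"
    by simp
  then have "rev (alt_word a b n) \<approx> rev (alt_word b a n)" by (rule eqW_cancel_left)
  then show ?thesis using eqW_rev by fastforce
qed

lemma eqA_lists: assumes "x \<simeq> y" shows "x \<in> lists S" "y \<in> lists S"
  using artin.gen_cong_in_lists[OF assms[unfolded eqA_def]] by auto

lemma eqA_refl: "x \<in> lists S \<Longrightarrow> x \<simeq> x"
  unfolding eqA_def by (rule gen_cong.refl) auto

lemma eqA_sym: "x \<simeq> y \<Longrightarrow> y \<simeq> x"
  unfolding eqA_def by (rule gen_cong.sym)

lemma eqA_trans [trans]: "x \<simeq> y \<Longrightarrow> y \<simeq> z \<Longrightarrow> x \<simeq> z"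
  unfolding eqA_def by (rule gen_cong.trans)

lemma eqA_append: "x \<simeq> y \<Longrightarrow> x' \<simeq> y' \<Longrightarrow> x @ x' \<simeq> y @ y'"
  unfolding eqA_def by (simp add: gen_cong.append)

lemma eqA_Cons: "x \<simeq> y \<Longrightarrow> s \<in> S \<Longrightarrow> s # x \<simeq> s # y"
  using eqA_append[of "[s]" "[s]" x y] eqA_refl[of "[s]"] by auto

lemma eqA_braid: assumes "a \<in> S" "b \<in> S" "m a b = enat n"
  shows "alt_word a b n \<simeq> alt_word b a n"
  unfolding eqA_def using assms by (intro gen_cong.base) (auto simp: artin_rels_def)

lemma eqA_length: "x \<simeq> y \<Longrightarrow> length x = length y"
  unfolding eqA_def by (induction rule: gen_cong.induct) (auto simp: artin_rels_def)

lemma eqA_eqW: "x \<simeq> y \<Longrightarrow> x \<approx> y"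
  unfolding eqA_def
proof (induction rule: gen_cong.induct)
  case (base x y)
  then show ?case by (auto simp: artin_rels_def intro: eqW_braid)
qed (auto intro: eqW_refl eqW_sym eqW_trans eqW_append)

text \<open>All relators have even length, so the group has a sign homomorphism. Multiplication by a generator
  therefore never preserves the length.\<close>
lemma eqW_parity: "x \<approx> y \<Longrightarrow> even (length x) = even (length y)"
proof -
  have "even (length x) = even (length y)"
    if "(x, y) \<in> gen_cong (S \<times> UNIV) cox_rels" for x y
    using that
  proof (induction rule: gen_cong.induct)
    case (base x y)
    have "even (length (concat (replicate n [(a, True), (b, True)])))" for n and a b :: 'a
      by (induction n) auto
    with base show ?case by (auto simp: group_rels_def coxeter_relators_def)
  qed auto
  then show "x \<approx> y \<Longrightarrow> even (length x) = even (length y)"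
    unfolding eqW_def by fastforce
qed

section \<open>Reduced words\<close>

definition red :: "'a list \<Rightarrow> bool"
  where "red w \<longleftrightarrow> w \<in> lists S \<and> (\<forall>v. v \<approx> w \<longrightarrow> length w \<le> length v)"

lemma red_lists: "red w \<Longrightarrow> w \<in> lists S" by (simp add: red_def)

lemma red_Nil [simp]: "red []" by (simp add: red_def)

lemma red_eqW: "red w \<Longrightarrow> v \<approx> w \<Longrightarrow> length v = length w \<Longrightarrow> red v"
  unfolding red_def using eqW_lists eqW_trans by metis

lemma red_eqA: "v \<simeq> w \<Longrightarrow> red v \<longleftrightarrow> red w"
  by (meson eqA_eqW eqA_length eqA_sym red_eqW)

lemma red_length_eq: "red v \<Longrightarrow> red w \<Longrightarrow> v \<approx> w \<Longrightarrow> length v = length w"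
  unfolding red_def using eqW_sym by (meson le_antisym)

lemma red_rev: "red w \<Longrightarrow> red (rev w)"
  unfolding red_def by (metis eqW_rev in_lists_conv_set length_rev rev_rev_ident set_rev)

lemma red_appendD: assumes "red (x @ y)" shows "red x" "red y"
proof -
  have l: "x \<in> lists S" "y \<in> lists S" using red_lists[OF assms] by auto
  show "red x"
    unfolding red_def
  proof (intro conjI allI impI)
    fix v assume "v \<approx> x"
    then have "v @ y \<approx> x @ y" using l by (simp add: eqW_appR)
    then show "length x \<le> length v" using assms unfolding red_def by fastforce
  qed (rule l)
  show "red y"
    unfolding red_def
  proof (intro conjI allI impI)
    fix v assume "v \<approx> y"
    then have "x @ v \<approx> x @ y" using l by (simp add: eqW_appL)
    then show "length y \<le> length v" using assms unfolding red_def by fastforce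
  qed (rule l)
qed

lemma red_ConsD: "red (s # w) \<Longrightarrow> s \<in> S \<and> red w"
  using red_appendD(2)[of "[s]" w] red_lists[of "s # w"] by auto

lemma red_no_square: "\<not> red (a # a # w)"
proof
  assume r: "red (a # a # w)"
  then have "w \<approx> a # a # w" using eqW_sym[OF eqW_cancel_head] red_lists by fastforce
  with r show False unfolding red_def by fastforce
qed

lemma red_exists: assumes "w \<in> lists S" obtains v where "red v" "v \<approx> w"
proof -
  obtain v where "v \<approx> w" "\<forall>y. y \<approx> w \<longrightarrow> length v \<le> length y"
    using ex_has_least_nat[of "\<lambda>v. v \<approx> w" w length] eqW_refl[OF assms] by blast
  then have "red v" unfolding red_def using eqW_lists eqW_trans by metis
  with \<open>v \<approx> w\<close> that show ?thesis by blast
qed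

text \<open>The exchange condition for left descents: a shortest word for \<open>s w\<close> has length \<open>length w - 1\<close> by
  parity, and prefixing \<open>s\<close> gives back \<open>w\<close>.\<close>
lemma not_red_Cons:
  assumes w: "red w" and s: "s \<in> S" and n: "\<not> red (s # w)"
  obtains v where "red (s # v)" "s # v \<approx> w" "length w = Suc (length v)"
proof -
  have l: "s # w \<in> lists S" using red_lists w s by auto
  obtain v where v: "red v" "v \<approx> s # w" using red_exists[OF l] .
  have "length v < Suc (length w)"
    using n v l unfolding red_def
    by (metis eqW_sym eqW_trans leI le_trans length_Cons)
  moreover have "even (length v) = even (Suc (length w))" using eqW_parity[OF v(2)] by simp
  ultimately have lt: "Suc (length v) \<le> length w" by (metis Suc_leI even_Suc less_antisym)
  have eq: "s # v \<approx> w"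
    using eqW_trans[OF eqW_Cons[OF v(2) s] eqW_cancel_head] red_lists[OF w] s by blast
  then have len: "length w = Suc (length v)" using w lt unfolding red_def by fastforce
  with eq w have "red (s # v)" using red_eqW by fastforce
  with eq len that show ?thesis by blast
qed

section \<open>A linear action of the Coxeter group\<close>

text \<open>Minus twice the bilinear form of the geometric representation. The value \<open>-2\<close> on the diagonal is the
  case \<open>n = 1\<close> of the cosine.\<close>
definition bond :: "'a \<Rightarrow> 'a \<Rightarrow> real"
  where "bond a b = (case m a b of enat n \<Rightarrow> 2 * cos (pi / real n) | \<infinity> \<Rightarrow> 2)"

text \<open>The contragredient action of a generator, written in coordinates: a move of Mozes' numbers game,
  which negates the value at \<open>s\<close> and adds multiples of the old value to the others.\<close>
definition fire :: "'a \<Rightarrow> ('a \<Rightarrow> real) \<Rightarrow> 'a \<Rightarrow> real"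
  where "fire s f = (\<lambda>r. f r + bond s r * f s)"

definition act :: "'a list \<Rightarrow> ('a \<Rightarrow> real) \<Rightarrow> 'a \<Rightarrow> real"
  where "act w f = foldr fire w f"

lemma act_simps [simp]:
  "act [] f = f" "act (s # w) f = fire s (act w f)" "act (x @ y) f = act x (act y f)"
  by (simp_all add: act_def)

lemma bond_sym: "a \<in> S \<Longrightarrow> b \<in> S \<Longrightarrow> bond a b = bond b a"
  by (simp add: bond_def symmetric)

lemma bond_self: "a \<in> S \<Longrightarrow> bond a a = - 2"
  by (simp add: bond_def diagonal one_enat_def)

lemma fire_self: "a \<in> S \<Longrightarrow> fire a f a = - f a"
  by (simp add: fire_def bond_self)

lemma fire_fire: "a \<in> S \<Longrightarrow> fire a (fire a f) = f"
  by (auto simp: fire_def bond_self algebra_simps)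

text \<open>The pair \<open>(f a, f b)\<close> is rotated in the plane, and every other value changes by multiples of the
  values that have been fired. The sums of the fired values up to time \<open>j\<close> have a closed form that
  contains the factor \<open>cheb c j\<close>; it vanishes when \<open>j\<close> is the order of the rotation.\<close>
lemma act_pairs:
  assumes a: "a \<in> S" and b: "b \<in> S"
  defines "c \<equiv> bond a b"
  shows "act (concat (replicate j [a, b])) f r = f r
    + bond b r * (cheb c j * (cheb c j * f b + (c * cheb c j - cheb c (Suc j)) * f a))
    + bond a r * (cheb c j * (cheb c (Suc j) * f b + cheb c j * f a))"
proof (induction j arbitrary: r)
  case (Suc j)
  \<comment> \<open>After naming the quantities the step consists of polynomial identities modulo the invariant.\<close>
  define u v x y where "u = cheb c j" and "v = cheb c (Suc j)" and "x = f a" and "y = f b"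
  define F where "F = act (concat (replicate j [a, b])) f"
  have uv: "v\<^sup>2 = 1 - u\<^sup>2 + c * u * v"
    using cheb_invariant[of c j] by (simp add: u_def v_def algebra_simps)
  have F: "F r = f r + bond b r * (u * (u * y + (c * u - v) * x)) + bond a r * (u * (v * y + u * x))" for r
    using Suc.IH unfolding F_def u_def v_def x_def y_def by simp
  have Fb: "F b = y - 2 * (u * (u * y + (c * u - v) * x)) + c * (u * (v * y + u * x))"
    using F[of b] b by (simp add: bond_self c_def y_def)
  have Fa: "F a = x + c * (u * (u * y + (c * u - v) * x)) - 2 * (u * (v * y + u * x))"
    using F[of a] a b by (simp add: bond_self bond_sym[OF b a] c_def x_def)
  have Y: "u * (u * y + (c * u - v) * x) + F b = v * (v * y + u * x)"
    using uv unfolding Fb by algebra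
  have X: "u * (v * y + u * x) + (F a + c * F b) = v * ((c * v - u) * y + v * x)"
    using uv unfolding Fa Fb by algebra
  have "act (concat (replicate (Suc j) [a, b])) f r
      = F r + bond b r * F b + bond a r * (F a + bond b a * F b)"
    by (simp add: F_def fire_def)
  also have "\<dots> = F r + bond b r * F b + bond a r * (F a + c * F b)"
    using bond_sym[OF a b] by (simp add: c_def)
  also have "\<dots> = f r + bond b r * (u * (u * y + (c * u - v) * x) + F b)
      + bond a r * (u * (v * y + u * x) + (F a + c * F b))"
    unfolding F[of r] by (simp add: algebra_simps)
  also have "\<dots> = f r + bond b r * (v * (v * y + u * x)) + bond a r * (v * ((c * v - u) * y + v * x))"
    by (simp only: X Y)
  finally show ?case by (simp add: u_def v_def x_def y_def)
qed simp

lemma finite_bond_sin: assumes "2 \<le> n" shows "sin (pi / real n) > 0"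
  using assms by (intro sin_gt_zero) (auto simp: field_simps)

lemma act_relator:
  assumes a: "a \<in> S" and b: "b \<in> S" and n: "m a b = enat n"
  shows "act (concat (replicate n [a, b])) f = f"
proof (cases "a = b")
  case True
  then have "n = 1" using n diagonal[OF b] by (simp add: one_enat_def)
  with True b show ?thesis by (simp add: fire_fire)
next
  case False
  then have n2: "2 \<le> n" using off_diagonal[OF a b] n by (simp add: numeral_eq_enat)
  have "cheb (bond a b) n = 0"
    using cheb_sin[of "pi / real n" n] finite_bond_sin[OF n2] n2 by (simp add: bond_def n)
  then show ?thesis by (auto simp: act_pairs[OF a b])
qed

lemma act_eqW: assumes "x \<approx> y" shows "act x f = act y f"
proof -
  have "act (map fst x) f = act (map fst y) f"
    if "(x, y) \<in> gen_cong (S \<times> UNIV) cox_rels" for x y f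
    using that
  proof (induction arbitrary: f rule: gen_cong.induct)
    case (base x y)
    have "map fst (concat (replicate n [(a, True), (b, True)])) = concat (replicate n [a, b])"
      for n and a b :: 'a by (induction n) auto
    with base show ?case
      by (auto simp: group_rels_def coxeter_relators_def fire_fire act_relator)
  qed auto
  from this[of "map (\<lambda>s. (s, True)) x" "map (\<lambda>s. (s, True)) y"] show ?thesis
    using assms unfolding eqW_def by (simp add: comp_def)
qed

lemma act_alt_word:
  assumes "s \<in> S" "t \<in> S"
  shows "act (alt_word t s k) g s =
    (if even k then cheb (bond s t) (Suc k) * g s + cheb (bond s t) k * g t
     else cheb (bond s t) k * g s + cheb (bond s t) (Suc k) * g t)"
  using assms
proof (induction k arbitrary: s t rule: less_induct)
  case (less k)
  consider "k = 0" | "k = 1" | j where "k = Suc (Suc j)"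
    by (metis One_nat_def not0_implies_Suc)
  then show ?case
  proof cases
    case 2
    then show ?thesis using bond_sym less.prems by (simp add: fire_def)
  next
    case 3
    let ?c = "bond s t"
    have c: "bond t s = ?c" using bond_sym less.prems by blast
    have "act (alt_word t s k) g s = act (alt_word s t (Suc j)) g s + ?c * act (alt_word s t (Suc j)) g t"
      by (simp add: 3 fire_def c)
    also have "act (alt_word s t (Suc j)) g s = - act (alt_word t s j) g s"
      using fire_self less.prems by simp
    finally have step: "act (alt_word t s k) g s
      = - act (alt_word t s j) g s + ?c * act (alt_word s t (Suc j)) g t" .
    have IH: "act (alt_word t s j) g s =
        (if even j then cheb ?c (Suc j) * g s + cheb ?c j * g t
         else cheb ?c j * g s + cheb ?c (Suc j) * g t)"
      "act (alt_word s t (Suc j)) g t =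
        (if even (Suc j) then cheb ?c (Suc (Suc j)) * g t + cheb ?c (Suc j) * g s
         else cheb ?c (Suc j) * g t + cheb ?c (Suc (Suc j)) * g s)"
      using less.IH[of j s t] less.IH[of "Suc j" t s] less.prems 3 c by auto
    show ?thesis
      unfolding step IH unfolding 3 by (simp add: algebra_simps)
  qed simp
qed

text \<open>The coefficients of \<open>g s\<close> and \<open>g t\<close> in the value at \<open>s\<close> are nonnegative and not both zero: for
  infinite \<open>m s t\<close> they are \<open>k\<close> and \<open>k + 1\<close>, for \<open>m s t = n\<close> they are multiples of the sines of
  \<open>k \<pi> / n\<close> and \<open>(k + 1) \<pi> / n\<close>, where \<open>k + 1 \<le> n\<close>.\<close>
lemma act_alt_word_pos:
  assumes s: "s \<in> S" and t: "t \<in> S" and st: "s \<noteq> t" and k: "enat k < m s t"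
    and pos: "g s > 0" "g t > 0"
  shows "act (alt_word t s k) g s > 0"
proof -
  let ?U = "cheb (bond s t)"
  have *: "?U k \<ge> 0 \<and> ?U (Suc k) \<ge> 0 \<and> (?U k > 0 \<or> ?U (Suc k) > 0)"
  proof (cases "m s t")
    case (enat n)
    then have n2: "2 \<le> n" using off_diagonal[OF s t st] by (simp add: numeral_eq_enat)
    have kn: "k < n" using k enat by simp
    have sn: "sin (pi / real n) > 0" by (rule finite_bond_sin[OF n2])
    have U: "?U j = sin (real j * (pi / real n)) / sin (pi / real n)" for j
      using cheb_sin[of "pi / real n" j] sn by (simp add: bond_def enat field_simps)
    have "0 \<le> ?U j" if "j \<le> n" for j
      unfolding U using that sn n2
      by (intro divide_nonneg_pos sin_ge_zero) (auto simp: field_simps)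
    moreover have "0 < ?U j" if "j < n" "0 < j" for j
      unfolding U using that sn n2
      by (intro divide_pos_pos sin_gt_zero) (auto simp: field_simps)
    ultimately show ?thesis using kn by (cases "k = 0") auto
  next
    case infinity
    then show ?thesis by (simp add: bond_def cheb_2)
  qed
  show ?thesis
    unfolding act_alt_word[OF s t] using * pos
    by (auto intro: add_pos_nonneg add_nonneg_pos)
qed

section \<open>Descents, dihedral prefixes and Matsumoto's theorem\<close>

text \<open>A longer alternating word contains a braid relation next to a letter that then squares to \<open>1\<close>.\<close>
lemma red_alt_word_le:
  assumes r: "red (alt_word c d k @ v)" and cd: "c \<in> S" "d \<in> S"
  shows "enat k \<le> m c d"
proof (rule ccontr)
  assume "\<not> enat k \<le> m c d"
  then obtain n where n: "m c d = enat n" "n < k" by (cases "m c d") auto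
  have "n \<noteq> 0"
    using n(1) diagonal[OF cd(1)] off_diagonal[OF cd] by (cases "c = d") (auto simp: numeral_eq_enat one_enat_def)
  then obtain n' where n': "n = Suc n'" using not0_implies_Suc by blast
  have "alt_word c d k = alt_word c d (Suc n) @ drop (Suc n) (alt_word c d k)"
    using take_alt_word[of "Suc n" k c d] n(2) by (metis Suc_leI append_take_drop_id)
  then have r': "red (alt_word c d (Suc n))" using r by (metis append_assoc red_appendD(1))
  have "alt_word d c n \<approx> alt_word c d n" using eqW_braid[OF cd(2,1)] n(1) symmetric[OF cd] by simp
  then have e: "c # alt_word d c n \<approx> c # alt_word c d n" using cd by (simp add: eqW_Cons)
  have "red (c # alt_word c d n)" using red_eqW[OF r' eqW_sym] e by simp
  then show False using n' red_no_square by simp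
qed

lemma red_two_letters:
  assumes "red x" "x \<in> lists {s, t}"
  shows "x = alt_word s t (length x) \<or> x = alt_word t s (length x)"
  using assms
proof (induction x)
  case (Cons a x)
  then have IH: "x = alt_word s t (length x) \<or> x = alt_word t s (length x)" and a: "a = s \<or> a = t"
    using red_ConsD by auto
  show ?case
  proof (cases x)
    case Nil
    then show ?thesis using a by auto
  next
    case (Cons y ys)
    with \<open>red (a # x)\<close> have "a \<noteq> y" using red_no_square by blast
    then show ?thesis using IH a Cons by auto
  qed
qed simp

lemma red_Cons_cong: assumes "red w" "red v" "w \<approx> v" shows "red (s # w) \<longleftrightarrow> red (s # v)"
proof -
  have "red (s # y)" if "red (s # x)" "x \<approx> y" "length x = length y" for x y
    using red_eqW[OF that(1), of "s # y"] that eqW_sym eqW_Cons red_ConsD by auto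
  then show ?thesis using assms red_length_eq eqW_sym by metis
qed

lemma not_red_Cons_head: "red (s # v) \<Longrightarrow> w \<approx> s # v \<Longrightarrow> red w \<Longrightarrow> \<not> red (s # w)"
  using red_Cons_cong red_no_square by blast

text \<open>The decomposition of a group element along the subgroup generated by \<open>s\<close> and \<open>t\<close>: a longest prefix in
  these two letters leaves a remainder \<open>v\<close> for which both are ascents, and a reduced word in
  two letters alternates.\<close>
lemma dihedral_split:
  assumes w: "red w" and s: "s \<in> S" and t: "t \<in> S"
  obtains c d k v where "c = s \<and> d = t \<or> c = t \<and> d = s" "alt_word c d k @ v \<approx> w"
    "red (alt_word c d k @ v)" "red (s # v)" "red (t # v)" "length w = k + length v"
proof -
  \<comment> \<open>The words \<open>v\<close> that remain when a prefix in \<open>s\<close> and \<open>t\<close> is split off without loss of length; the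
    shortest one is wanted.\<close>
  define Q where "Q v \<longleftrightarrow> (\<exists>x\<in>lists {s, t}. x @ v \<approx> w \<and> length w = length x + length v)" for v
  have "Q w" unfolding Q_def using eqW_refl red_lists[OF w] by (intro bexI[of _ "[]"]) auto
  then obtain v where v: "Q v" and min: "\<And>y. Q y \<Longrightarrow> length v \<le> length y"
    using ex_has_least_nat[of Q w length] by blast
  obtain x where x: "x \<in> lists {s, t}" "x @ v \<approx> w" "length w = length x + length v"
    using v unfolding Q_def by blast
  have r: "red (x @ v)" using red_eqW[OF w x(2)] x(3) by simp
  have asc: "red (r # v)" if "r \<in> {s, t}" for r
  proof (rule ccontr)
    assume "\<not> red (r # v)"
    moreover have "r \<in> S" using that s t by auto
    ultimately obtain v' where v': "r # v' \<approx> v" "length v = Suc (length v')"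
      using not_red_Cons red_appendD(2)[OF r] by metis
    have "x @ r # v' \<approx> x @ v" using eqW_appL[OF v'(1)] red_lists[OF red_appendD(1)[OF r]] by simp
    then have "(x @ [r]) @ v' \<approx> w" using x(2) eqW_trans by simp
    then have "Q v'" unfolding Q_def using x that v'(2) by (intro bexI[of _ "x @ [r]"]) auto
    then show False using min v'(2) by fastforce
  qed
  have "x = alt_word s t (length x) \<or> x = alt_word t s (length x)"
    using red_two_letters red_appendD(1)[OF r] x(1) by blast
  then show ?thesis
    using that[of s t "length x" v] that[of t s "length x" v] asc[of s] asc[of t] r x(2,3)
    by fastforce
qed

abbreviation unit_fun :: "'a \<Rightarrow> real" where "unit_fun \<equiv> \<lambda>_. 1"

text \<open>The constant function \<open>1\<close> lies in the fundamental chamber. If \<open>w\<close> begins with \<open>t\<close>, split off the part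
  in \<open>s\<close> and \<open>t\<close>: the shorter remainder is positive at \<open>s\<close> and at \<open>t\<close> by induction, and the
  alternating part, which is too short to be rewritten so as to start with \<open>s\<close>, keeps the value at \<open>s\<close>
  positive.\<close>
lemma ascent_pos: "red (s # w) \<Longrightarrow> act w unit_fun s > 0"
proof (induction "length w" arbitrary: w s rule: less_induct)
  case less
  have s: "s \<in> S" and w: "red w" using red_ConsD less.prems by blast+
  show ?case
  proof (cases w)
    case (Cons t w0)
    have t: "t \<in> S" using w Cons red_ConsD by blast
    have st: "s \<noteq> t" using less.prems Cons red_no_square by blast
    obtain c d k v where d: "c = s \<and> d = t \<or> c = t \<and> d = s" "alt_word c d k @ v \<approx> w"
      "red (alt_word c d k @ v)" "red (s # v)" "red (t # v)" "length w = k + length v"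
      using dihedral_split[OF w s t] .
    have "k \<noteq> 0"
    proof
      assume "k = 0"
      then have "v \<approx> t # w0" using d(2) Cons by simp
      with d(5) w Cons show False using not_red_Cons_head red_ConsD by blast
    qed
    then obtain k' where k': "k = Suc k'" using not0_implies_Suc by blast
    \<comment> \<open>Otherwise \<open>w\<close> has a reduced word that starts with \<open>s\<close>, although \<open>s\<close> is an ascent.\<close>
    have nos: "\<not> alt_word s t k @ v \<approx> w"
    proof
      assume e: "alt_word s t k @ v \<approx> w"
      then have "red (alt_word s t k @ v)" using red_eqW[OF w] d(6) by simp
      with e less.prems w show False
        using k' not_red_Cons_head[OF _ eqW_sym] by simp
    qed
    then have cd: "c = t" "d = s" using d(1,2) by auto
    have "m t s \<noteq> enat k"
    proof
      assume "m t s = enat k"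
      then have "m s t = enat k" using symmetric s t by simp
      then have "alt_word s t k @ v \<approx> alt_word t s k @ v"
        using eqW_appR[OF eqW_braid[OF s t]] red_lists red_ConsD d(4) by blast
      then show False using nos d(2) cd eqW_trans by blast
    qed
    moreover have "enat k \<le> m t s" using red_alt_word_le[OF d(3)] cd s t by simp
    ultimately have "enat k < m s t" using symmetric[OF s t] by simp
    moreover have "length v < length w" using d(6) k' by simp
    ultimately have "act (alt_word t s k) (act v unit_fun) s > 0"
      using less.hyps d(4,5) s t st by (intro act_alt_word_pos) auto
    then show ?thesis using act_eqW[OF d(2)] cd by simp
  qed simp
qed

lemma red_Cons_if_pos:
  assumes w: "red w" and s: "s \<in> S" and pos: "act w unit_fun s > 0"
  shows "red (s # w)"
proof (rule ccontr)
  assume "\<not> red (s # w)"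
  then obtain v where v: "red (s # v)" "s # v \<approx> w" using not_red_Cons[OF w s] by blast
  have "act w unit_fun s = - act v unit_fun s"
    using act_eqW[OF v(2), of unit_fun] fire_self[OF s] by (metis act_simps(2))
  then show False using ascent_pos[OF v(1)] pos by simp
qed

text \<open>If the alternating part of \<open>dihedral_split\<close> were shorter than \<open>m a b\<close>, then the letter that it does
  not start with would have a positive value and hence be an ascent. In particular \<open>m a b\<close> is finite.\<close>
lemma two_descents:
  assumes w: "red w" and a: "a \<in> S" and b: "b \<in> S" and ab: "a \<noteq> b"
    and da: "\<not> red (a # w)" and db: "\<not> red (b # w)"
  obtains n v where "m a b = enat n" "alt_word a b n @ v \<approx> w" "red (alt_word a b n @ v)"
proof -
  obtain c d k v where d: "c = a \<and> d = b \<or> c = b \<and> d = a" "alt_word c d k @ v \<approx> w"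
    "red (alt_word c d k @ v)" "red (a # v)" "red (b # v)" "length w = k + length v"
    using dihedral_split[OF w a b] .
  have cd: "c \<in> S" "d \<in> S" "d \<noteq> c" using d(1) a b ab by auto
  have "\<not> red (d # w)" using d(1) da db by auto
  then have npos: "\<not> act w unit_fun d > 0" using red_Cons_if_pos[OF w] cd by blast
  have "\<not> enat k < m d c"
  proof
    assume k: "enat k < m d c"
    have "act v unit_fun d > 0" "act v unit_fun c > 0"
      using ascent_pos d(1,4,5) by auto
    then have "act (alt_word c d k) (act v unit_fun) d > 0"
      using act_alt_word_pos[OF cd(2,1,3) k] by blast
    with npos show False using act_eqW[OF d(2), of unit_fun] by simp
  qed
  moreover have "enat k \<le> m c d" using red_alt_word_le[OF d(3)] cd by simp
  ultimately have mk: "m c d = enat k" using symmetric[OF cd(1,2)] by simp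
  have "alt_word c d k \<approx> alt_word a b k"
  proof (cases "c = a")
    case True
    then show ?thesis using d(1) ab a b eqW_refl alt_word_lists by metis
  next
    case False
    then have "c = b" "d = a" using d(1) by auto
    then show ?thesis using eqW_braid[OF cd(1,2) mk] by simp
  qed
  then have "alt_word c d k @ v \<approx> alt_word a b k @ v"
    using eqW_appR red_lists red_ConsD d(4) by blast
  then have e: "alt_word a b k @ v \<approx> w" using d(2) eqW_sym eqW_trans by blast
  have "m a b = enat k" using mk d(1) symmetric[OF a b] by auto
  moreover have "red (alt_word a b k @ v)" using red_eqW[OF w e] d(6) by simp
  ultimately show ?thesis using that e by blast
qed

text \<open>Both letters are positive at \<open>v\<close>, and an alternating part shorter than \<open>m a b\<close> keeps the letter that it
  does not start with positive, so this letter can be put in front.\<close>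
lemma two_ascents:
  assumes "red (a # v)" "red (b # v)" "a \<noteq> b" "enat k \<le> m a b"
  shows "red (alt_word a b k @ v)"
  using assms
proof (induction k arbitrary: a b)
  case 0
  then show ?case using red_ConsD by auto
next
  case (Suc k)
  have ab: "a \<in> S" "b \<in> S" using Suc.prems red_ConsD by auto
  have k: "enat k < m a b" using Suc.prems(4) by (simp add: Suc_ile_eq)
  then have r: "red (alt_word b a k @ v)"
    using Suc.IH[of b a] Suc.prems symmetric[OF ab] by auto
  have "act (alt_word b a k) (act v unit_fun) a > 0"
    using act_alt_word_pos[OF ab Suc.prems(3) k] ascent_pos Suc.prems by blast
  then show ?case using red_Cons_if_pos[OF r ab(1)] by simp
qed

text \<open>If the first letters \<open>a\<close> and \<open>b\<close> differ, both are descents, so there is a third word that begins with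
  \<open>alt_word a b n\<close>. It is compared with \<open>x\<close> after removing \<open>a\<close>, its braided form with \<open>y\<close> after
  removing \<open>b\<close>, and the two forms differ by one braid relation.\<close>
theorem Matsumoto: "red x \<Longrightarrow> red y \<Longrightarrow> x \<approx> y \<Longrightarrow> x \<simeq> y"
proof (induction "length x" arbitrary: x y rule: less_induct)
  case less
  have len: "length x = length y" using red_length_eq less.prems by blast
  have tail: "u # x' \<simeq> u # y'" if "u # x' \<approx> u # y'" "red (u # x')" "red (u # y')" "length x = length (u # x')"
    for u x' y'
  proof -
    have "x' \<approx> y'" using eqW_cancel_left[of "[u]" x' y'] that(1) by simp
    then have "x' \<simeq> y'" using less.hyps[of x' y'] that red_ConsD by auto
    then show ?thesis using eqA_Cons that(2) red_ConsD by blast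
  qed
  show ?case
  proof (cases x)
    case Nil
    then show ?thesis using len by (simp add: eqA_refl)
  next
    case (Cons a x')
    with len obtain b y' where y: "y = b # y'" by (cases y) auto
    have ab: "a \<in> S" "b \<in> S" using less.prems Cons y red_ConsD by auto
    show ?thesis
    proof (cases "a = b")
      case True
      then show ?thesis using tail[of a x' y'] less.prems Cons y by simp
    next
      case False
      have "\<not> red (a # x)" using Cons red_no_square by simp
      moreover have "\<not> red (b # x)" using not_red_Cons_head less.prems y by blast
      ultimately obtain n v where n: "m a b = enat n" "alt_word a b n @ v \<approx> x" "red (alt_word a b n @ v)"
        using two_descents[OF less.prems(1) ab False] by blast
      have "n \<noteq> 0" using off_diagonal[OF ab False] n(1) by (auto simp: numeral_eq_enat)
      then obtain n' where n': "n = Suc n'" using not0_implies_Suc by blast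
      have v: "v \<in> lists S" using red_lists[OF red_appendD(2)[OF n(3)]] .
      have br: "alt_word a b n @ v \<simeq> alt_word b a n @ v"
        using eqA_append[OF eqA_braid[OF ab n(1)] eqA_refl[OF v]] .
      have "x \<simeq> alt_word a b n @ v"
        using tail[of a x' "alt_word b a n' @ v"] n(2,3) n' Cons less.prems(1) eqW_sym by simp
      moreover have "alt_word b a n @ v \<approx> y" "red (alt_word b a n @ v)"
        using eqA_eqW[OF eqA_sym[OF br]] n(2) less.prems(3) eqW_trans red_eqA[OF br] n(3) by blast+
      then have "y \<simeq> alt_word b a n @ v"
        using tail[of b y' "alt_word a b n' @ v"] n' y less.prems(2) len eqW_sym by simp
      ultimately show ?thesis using br eqA_sym eqA_trans by blast
    qed
  qed
qed

section \<open>Reduced elements of the Artin monoid\<close>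

abbreviation M where "M \<equiv> artin_monoid S m"
abbreviation Red where "Red \<equiv> M_red S m"
abbreviation dvdM (infix "\<preceq>" 50) where "x \<preceq> y \<equiv> x divides\<^bsub>M\<^esub> y"

lemma M_eq: "M = artin.PM" by (simp add: artin_monoid_def)

sublocale M: Group.monoid M
  unfolding M_eq by (rule artin.monoid_PM)

definition el :: "'a list \<Rightarrow> 'a list set"
  where "el w = gen_cong S (artin_rels S m) `` {w}"

lemma el_carrier [simp]: "w \<in> lists S \<Longrightarrow> el w \<in> carrier M"
  unfolding M_eq el_def by (rule artin.cls_carrier)

lemma carrier_el: assumes "u \<in> carrier M" obtains w where "w \<in> lists S" "u = el w"
  using assms artin.carrier_cls unfolding M_eq el_def by blast

lemma el_mult: "x \<in> lists S \<Longrightarrow> y \<in> lists S \<Longrightarrow> el x \<otimes>\<^bsub>M\<^esub> el y = el (x @ y)"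
  unfolding M_eq el_def by (rule artin.cls_mult)

lemma one_el: "\<one>\<^bsub>M\<^esub> = el []"
  unfolding M_eq el_def by (rule artin.one_cls)

lemma el_eq_iff: "x \<in> lists S \<Longrightarrow> y \<in> lists S \<Longrightarrow> el x = el y \<longleftrightarrow> x \<simeq> y"
  unfolding el_def eqA_def by (rule artin.cls_eq_iff)

lemma el_eqI: "x \<simeq> y \<Longrightarrow> el x = el y"
  using el_eq_iff eqA_lists by blast

lemma artin_length_el [simp]: assumes "w \<in> lists S" shows "artin_length (el w) = length w"
proof -
  have "v \<in> el w \<longleftrightarrow> w \<simeq> v" for v by (simp add: el_def eqA_def)
  then have "w \<in> el w" "\<And>v. v \<in> el w \<Longrightarrow> length v = length w"
    using eqA_refl[OF assms] eqA_length[of w] by auto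
  then have "length ` el w = {length w}" by blast
  then show ?thesis by (simp add: artin_length_def)
qed

lemma artin_length_mult:
  assumes "u \<in> carrier M" "v \<in> carrier M"
  shows "artin_length (u \<otimes>\<^bsub>M\<^esub> v) = artin_length u + artin_length v"
  using assms by (elim carrier_el) (simp add: el_mult)

lemma artin_length_0_iff: assumes "u \<in> carrier M" shows "artin_length u = 0 \<longleftrightarrow> u = \<one>\<^bsub>M\<^esub>"
proof -
  obtain w where w: "w \<in> lists S" "u = el w" using assms by (rule carrier_el)
  have "length w = 0" if "el w = el []" using that w artin_length_el[of w] artin_length_el[of "[]"] by simp
  then show ?thesis using w by (auto simp: one_el)
qed

lemma coxeter_eval_pos:
  assumes "w \<in> lists S"
  shows "coxeter_eval S m w = cox.cls (map (\<lambda>s. (s, True)) w)"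
proof -
  have "coxeter_eval S m w = list_mult cox.PM (map cox.cls (map (\<lambda>s. [(s, True)]) w))"
    by (simp add: coxeter_eval_def coxeter_group_def presented_group_def coxeter_gen_def[abs_def] comp_def)
  also have "\<dots> = cox.cls (concat (map (\<lambda>s. [(s, True)]) w))"
    by (rule cox.list_mult_cls) (use assms in auto)
  also have "concat (map (\<lambda>s. [(s, True)]) w) = map (\<lambda>s. (s, True)) w"
    by (induction w) auto
  finally show ?thesis .
qed

lemma coxeter_eval_eq_iff:
  assumes "v \<in> lists S" "w \<in> lists S"
  shows "coxeter_eval S m v = coxeter_eval S m w \<longleftrightarrow> v \<approx> w"
  unfolding coxeter_eval_pos[OF assms(1)] coxeter_eval_pos[OF assms(2)] eqW_def
  by (rule cox.cls_eq_iff) (use assms in auto)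

lemma artin_to_coxeter_el:
  assumes "w \<in> lists S" shows "artin_to_coxeter S m (el w) = coxeter_eval S m w"
proof -
  have "coxeter_eval S m v = coxeter_eval S m w" if "v \<in> el w" for v
  proof -
    have "w \<simeq> v" using that by (simp add: el_def eqA_def)
    then show ?thesis using coxeter_eval_eq_iff eqA_eqW eqA_lists eqA_sym by blast
  qed
  moreover have "w \<in> el w" using eqA_refl[OF assms] by (simp add: el_def eqA_def)
  ultimately have "coxeter_eval S m ` el w = {coxeter_eval S m w}" by blast
  then show ?thesis by (simp add: artin_to_coxeter_def)
qed

text \<open>The bridge between the two descriptions of reducedness: the length of the image in the Coxeter
  group is the minimal length of an equivalent word.\<close>
lemma el_Red_iff: assumes w: "w \<in> lists S" shows "el w \<in> Red \<longleftrightarrow> red w"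
proof -
  let ?P = "\<lambda>n. \<exists>v\<in>lists S. length v = n \<and> coxeter_eval S m v = coxeter_eval S m w"
  have P: "?P n \<longleftrightarrow> (\<exists>v. v \<approx> w \<and> length v = n)" for n
    using coxeter_eval_eq_iff[OF _ w] eqW_lists(1) by blast
  have "el w \<in> Red \<longleftrightarrow> length w = Least ?P"
    using w by (simp add: M_red_def artin_to_coxeter_el coxeter_length_def)
  also have "\<dots> \<longleftrightarrow> red w"
  proof
    assume l: "length w = Least ?P"
    show "red w" unfolding red_def
    proof (intro conjI allI impI)
      fix v assume "v \<approx> w"
      then have "?P (length v)" using P by blast
      then show "length w \<le> length v" unfolding l by (rule Least_le)
    qed (rule w)
  next
    assume "red w"
    then show "length w = Least ?P"
      unfolding red_def P by (intro Least_equality[symmetric]) (use eqW_refl[OF w] in auto)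
  qed
  finally show ?thesis .
qed

lemma Red_carrier: "u \<in> Red \<Longrightarrow> u \<in> carrier M"
  by (simp add: M_red_def)

lemma one_Red: "\<one>\<^bsub>M\<^esub> \<in> Red" by (simp add: one_el el_Red_iff)

lemma gen_Red: assumes "a \<in> S" shows "el [a] \<in> Red"
proof -
  have "red [a]"
    unfolding red_def
  proof (intro conjI allI impI)
    fix v assume "v \<approx> [a]"
    then have "odd (length v)" using eqW_parity by fastforce
    then show "length [a] \<le> length v" by (cases v) auto
  qed (use assms in auto)
  then show ?thesis using assms by (simp add: el_Red_iff)
qed

lemma Red_factors:
  assumes "u \<in> carrier M" "v \<in> carrier M" "u \<otimes>\<^bsub>M\<^esub> v \<in> Red"
  shows "u \<in> Red" "v \<in> Red"
proof -
  obtain x y where w: "x \<in> lists S" "y \<in> lists S" "u = el x" "v = el y"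
    using assms(1,2) by (metis carrier_el)
  then have "red (x @ y)" using assms(3) el_mult el_Red_iff[of "x @ y"] by simp
  then show "u \<in> Red" "v \<in> Red" using w el_Red_iff red_appendD by blast+
qed

text \<open>Cancellation within reduced elements takes place in the Coxeter group and is lifted by Matsumoto's
  theorem. Cancellation in the whole monoid is a later consequence.\<close>
lemma Red_cancel:
  assumes "x \<in> carrier M" "y \<in> carrier M" "z \<in> carrier M"
    and "x \<otimes>\<^bsub>M\<^esub> y \<in> Red" "x \<otimes>\<^bsub>M\<^esub> y = x \<otimes>\<^bsub>M\<^esub> z"
  shows "y = z"
proof -
  obtain X Y Z where w: "X \<in> lists S" "Y \<in> lists S" "Z \<in> lists S" "x = el X" "y = el Y" "z = el Z"
    using assms(1-3) by (metis carrier_el)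
  have sim: "X @ Y \<simeq> X @ Z" using assms(5) w by (simp add: el_mult el_eq_iff)
  have "red (X @ Y)" using assms(4) w by (simp add: el_mult el_Red_iff)
  then have r: "red (X @ Y)" "red (X @ Z)" using red_eqA[OF sim] by simp_all
  have "Y \<approx> Z" using eqA_eqW[OF sim] eqW_cancel_left by blast
  then have "Y \<simeq> Z" using Matsumoto r red_appendD by blast
  then show ?thesis using w el_eqI by simp
qed

lemma dvdM_trans: "x \<preceq> y \<Longrightarrow> y \<preceq> z \<Longrightarrow> x \<in> carrier M \<Longrightarrow> x \<preceq> z"
  by (meson M.divides_trans)

lemma dvdM_I: "y = x \<otimes>\<^bsub>M\<^esub> c \<Longrightarrow> c \<in> carrier M \<Longrightarrow> x \<preceq> y"
  unfolding factor_def by blast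

lemma dvdM_mult: "x \<in> carrier M \<Longrightarrow> y \<in> carrier M \<Longrightarrow> x \<preceq> x \<otimes>\<^bsub>M\<^esub> y"
  unfolding factor_def by blast

lemma dvdM_mult_left:
  assumes "x \<preceq> y" "z \<in> carrier M" "x \<in> carrier M" shows "z \<otimes>\<^bsub>M\<^esub> x \<preceq> z \<otimes>\<^bsub>M\<^esub> y"
  using assms unfolding factor_def by (metis M.m_assoc)

lemma dvdM_antisym:
  assumes "x \<preceq> y" "y \<preceq> x" "x \<in> carrier M" "y \<in> carrier M"
  shows "x = y"
proof -
  obtain c d where cd: "c \<in> carrier M" "d \<in> carrier M" "y = x \<otimes>\<^bsub>M\<^esub> c" "x = y \<otimes>\<^bsub>M\<^esub> d"
    using assms(1,2) unfolding factor_def by blast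
  then have "artin_length c = 0"
    using artin_length_mult[of x c] artin_length_mult[of y d] assms by simp
  then show ?thesis using cd assms artin_length_0_iff by simp
qed

text \<open>Local confluence. Both \<open>a\<close> and \<open>b\<close> are left descents of the cofactor of \<open>y\<close> in \<open>x\<close>, so \<open>y\<close> can be
  extended by their least common multiple within \<open>x\<close>; both are right ascents of \<open>w y\<close>, so the result
  stays reduced after multiplication by \<open>w\<close>.\<close>
lemma Red_join:
  assumes w: "w \<in> carrier M" and x: "x \<in> Red" and y: "y \<in> carrier M"
    and a: "a \<in> S" and b: "b \<in> S" and ab: "a \<noteq> b"
    and ya: "y \<otimes>\<^bsub>M\<^esub> el [a] \<preceq> x" "w \<otimes>\<^bsub>M\<^esub> (y \<otimes>\<^bsub>M\<^esub> el [a]) \<in> Red"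
    and yb: "y \<otimes>\<^bsub>M\<^esub> el [b] \<preceq> x" "w \<otimes>\<^bsub>M\<^esub> (y \<otimes>\<^bsub>M\<^esub> el [b]) \<in> Red"
  obtains d where "d \<in> carrier M" "d \<preceq> x" "w \<otimes>\<^bsub>M\<^esub> d \<in> Red"
    "y \<otimes>\<^bsub>M\<^esub> el [a] \<preceq> d" "y \<otimes>\<^bsub>M\<^esub> el [b] \<preceq> d"
proof -
  obtain z z' where z: "z \<in> carrier M" "x = y \<otimes>\<^bsub>M\<^esub> el [a] \<otimes>\<^bsub>M\<^esub> z"
    "z' \<in> carrier M" "x = y \<otimes>\<^bsub>M\<^esub> el [b] \<otimes>\<^bsub>M\<^esub> z'"
    using ya(1) yb(1) unfolding factor_def by blast
  obtain W Y Z Z' where l: "W \<in> lists S" "Y \<in> lists S" "Z \<in> lists S" "Z' \<in> lists S"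
    and e: "w = el W" "y = el Y" "z = el Z" "z' = el Z'"
    using w y z(1,3) by (metis carrier_el)
  have xe: "x = el (Y @ a # Z)" "x = el (Y @ b # Z')"
    using z l e a b by (simp_all add: el_mult)
  have sim: "Y @ a # Z \<simeq> Y @ b # Z'"
    using xe l a b by (simp add: el_eq_iff[symmetric])
  have "red (Y @ a # Z)" using x xe(1) l a el_Red_iff[of "Y @ a # Z"] by simp
  then have r: "red (Y @ a # Z)" "red (Y @ b # Z')" using red_eqA[OF sim] by simp_all
  have "a # Z \<approx> b # Z'" using eqW_cancel_left eqA_eqW[OF sim] by blast
  moreover have rz: "red (a # Z)" "red (b # Z')" using r red_appendD by blast+
  ultimately have "\<not> red (a # a # Z)" "\<not> red (b # a # Z)"
    using red_no_square not_red_Cons_head by blast+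
  then obtain n v where n: "m a b = enat n" "alt_word a b n @ v \<approx> a # Z" "red (alt_word a b n @ v)"
    using two_descents[OF rz(1) a b ab] by blast
  have alt: "alt_word a b n \<in> lists S" "alt_word b a n \<in> lists S" and v: "v \<in> lists S"
    using a b alt_word_lists red_lists red_appendD(2)[OF n(3)] by metis+
  have br: "alt_word a b n \<simeq> alt_word b a n" using eqA_braid[OF a b n(1)] .
  have "n \<noteq> 0" using off_diagonal[OF a b ab] n(1) by (auto simp: numeral_eq_enat)
  then obtain n' where n': "n = Suc n'" using not0_implies_Suc by blast
  define d where "d = el (Y @ alt_word a b n)"
  have d': "d = el (Y @ alt_word b a n)"
    unfolding d_def using br l(2) by (intro el_eqI eqA_append eqA_refl)
  show ?thesis
  proof
    show "d \<in> carrier M" unfolding d_def using l alt by simp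
    have eq: "Y @ alt_word a b n @ v \<approx> Y @ a # Z" using eqW_appL[OF n(2) l(2)] .
    have "length (alt_word a b n @ v) = length (a # Z)" using red_length_eq n(2,3) rz(1) by blast
    then have "red (Y @ alt_word a b n @ v)" using red_eqW[OF r(1) eq] by simp
    then have "x = el (Y @ alt_word a b n @ v)"
      using Matsumoto r(1) eq xe(1) el_eqI by metis
    then have "x = d \<otimes>\<^bsub>M\<^esub> el v" unfolding d_def using l alt v by (simp add: el_mult)
    then show "d \<preceq> x" by (rule dvdM_I) (use v in simp)
    have "red (W @ Y @ [a])" "red (W @ Y @ [b])"
      using ya(2) yb(2) l e a b el_Red_iff[of "W @ Y @ [a]"] el_Red_iff[of "W @ Y @ [b]"]
      by (simp_all add: el_mult)
    then have "red (a # rev (W @ Y))" "red (b # rev (W @ Y))"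
      using red_rev[of "W @ Y @ [a]"] red_rev[of "W @ Y @ [b]"] by simp_all
    then have "red (alt_word a b n @ rev (W @ Y))"
      using two_ascents ab n(1) by simp
    \<comment> \<open>Right ascents are left ascents of the reversed word; reversal fixes the common multiple because
      \<open>alt_word a b n\<close> and \<open>alt_word b a n\<close> represent the same element.\<close>
    then have "red (rev (alt_word a b n @ rev (W @ Y)))" by (rule red_rev)
    then have rr: "red (W @ Y @ rev (alt_word a b n))" by simp
    have "d = el (Y @ rev (alt_word a b n))"
      using d_def d' by (simp add: rev_alt_word)
    then have "w \<otimes>\<^bsub>M\<^esub> d = el (W @ Y @ rev (alt_word a b n))"
      using l alt e by (simp add: el_mult)
    then show "w \<otimes>\<^bsub>M\<^esub> d \<in> Red" using rr el_Red_iff[OF red_lists[OF rr]] by simp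
    have "d = y \<otimes>\<^bsub>M\<^esub> el [a] \<otimes>\<^bsub>M\<^esub> el (alt_word b a n')"
      using n' d_def l a b alt_word_lists[OF b a, of n'] e by (simp add: el_mult)
    then show "y \<otimes>\<^bsub>M\<^esub> el [a] \<preceq> d" by (rule dvdM_I) (simp add: a b alt_word_lists)
    have "d = y \<otimes>\<^bsub>M\<^esub> el [b] \<otimes>\<^bsub>M\<^esub> el (alt_word a b n')"
      using n' d' l a b alt_word_lists[OF a b, of n'] e by (simp add: el_mult)
    then show "y \<otimes>\<^bsub>M\<^esub> el [b] \<preceq> d" by (rule dvdM_I) (simp add: a b alt_word_lists)
  qed
qed

section \<open>Largest reduced extensions\<close>

definition completion :: "'a list set \<Rightarrow> 'a list set \<Rightarrow> 'a list set \<Rightarrow> bool"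
  where "completion w x y \<longleftrightarrow> y \<in> carrier M \<and> y \<preceq> x \<and> w \<otimes>\<^bsub>M\<^esub> y \<in> Red"

text \<open>The completions are closed under divisors, have bounded length, and are locally confluent by
  \<open>Red_join\<close>. As in Newman's lemma, every completion \<open>y\<close> therefore lies below a
  completion that dominates everything above \<open>y\<close>, and \<open>y = 1\<close> gives the claim.\<close>
lemma completion_maximum_exists:
  assumes w: "w \<in> Red" and x: "x \<in> Red"
  shows "\<exists>y. completion w x y \<and> (\<forall>z. completion w x z \<longrightarrow> z \<preceq> y)"
proof -
  let ?P = "completion w x"
  have step: "?P (y \<otimes>\<^bsub>M\<^esub> el [c])" and dv: "y \<otimes>\<^bsub>M\<^esub> el [c] \<preceq> z"
    if "?P z" "z = y \<otimes>\<^bsub>M\<^esub> el (c # Z)" "y \<in> carrier M" "c \<in> S" "Z \<in> lists S" for y z c Z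
  proof -
    have z: "z = y \<otimes>\<^bsub>M\<^esub> el [c] \<otimes>\<^bsub>M\<^esub> el Z" using that by (simp add: el_mult M.m_assoc)
    then show dv: "y \<otimes>\<^bsub>M\<^esub> el [c] \<preceq> z" by (rule dvdM_I) (use that in simp)
    have "w \<otimes>\<^bsub>M\<^esub> z = w \<otimes>\<^bsub>M\<^esub> (y \<otimes>\<^bsub>M\<^esub> el [c]) \<otimes>\<^bsub>M\<^esub> el Z"
      using z that Red_carrier[OF w] by (simp add: M.m_assoc)
    then have "w \<otimes>\<^bsub>M\<^esub> (y \<otimes>\<^bsub>M\<^esub> el [c]) \<in> Red"
      using that Red_carrier[OF w] Red_factors(1)[of "w \<otimes>\<^bsub>M\<^esub> (y \<otimes>\<^bsub>M\<^esub> el [c])" "el Z"]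
      by (simp add: completion_def)
    then show "?P (y \<otimes>\<^bsub>M\<^esub> el [c])"
      using that dv dvdM_trans[OF dv] by (simp add: completion_def)
  qed
  have cases: "z = y \<or> (\<exists>c Z. c \<in> S \<and> Z \<in> lists S \<and> z = y \<otimes>\<^bsub>M\<^esub> el (c # Z))"
    if yz: "y \<preceq> z" "y \<in> carrier M" for y z
  proof -
    obtain z' where z': "z' \<in> carrier M" "z = y \<otimes>\<^bsub>M\<^esub> z'" using yz unfolding factor_def by blast
    then obtain Z where "Z \<in> lists S" "z = y \<otimes>\<^bsub>M\<^esub> el Z" by (metis carrier_el)
    then show ?thesis using yz(2) by (cases Z) (auto simp flip: one_el)
  qed
  have carr: "y \<in> carrier M" if "?P y" for y using that by (simp add: completion_def)
  have max_above: "\<exists>t. ?P t \<and> (\<forall>z. ?P z \<and> y \<preceq> z \<longrightarrow> z \<preceq> t)" if "?P y" for y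
    using that
  proof (induction "artin_length x - artin_length y" arbitrary: y rule: less_induct)
    case less
    note y = carr[OF less.prems]
    have IH: "\<exists>t. ?P t \<and> (\<forall>z. ?P z \<and> y \<otimes>\<^bsub>M\<^esub> el [a] \<preceq> z \<longrightarrow> z \<preceq> t)"
      if "?P (y \<otimes>\<^bsub>M\<^esub> el [a])" "a \<in> S" for a
    proof -
      have "y \<otimes>\<^bsub>M\<^esub> el [a] \<preceq> x" using that(1) by (simp add: completion_def)
      then obtain e where e: "e \<in> carrier M" "x = y \<otimes>\<^bsub>M\<^esub> el [a] \<otimes>\<^bsub>M\<^esub> e"
        unfolding factor_def by blast
      have a: "el [a] \<in> carrier M" "artin_length (el [a]) = 1" using that(2) by simp_all
      have "artin_length x = artin_length y + 1 + artin_length e"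
        unfolding e(2) using y e(1) a by (simp add: artin_length_mult)
      then have "artin_length x - artin_length (y \<otimes>\<^bsub>M\<^esub> el [a]) < artin_length x - artin_length y"
        using y a by (simp add: artin_length_mult)
      then show ?thesis using less.hyps that(1) by blast
    qed
    show ?case
    proof (cases "\<exists>a\<in>S. ?P (y \<otimes>\<^bsub>M\<^esub> el [a])")
      case False
      then have "z = y" if "?P z" "y \<preceq> z" for z
        using cases[OF that(2) y] step[OF that(1) _ y] by blast
      then show ?thesis using less.prems M.divides_refl[OF y] by blast
    next
      case True
      then obtain a where a: "a \<in> S" "?P (y \<otimes>\<^bsub>M\<^esub> el [a])" by blast
      obtain t where t: "?P t" "\<And>z. ?P z \<Longrightarrow> y \<otimes>\<^bsub>M\<^esub> el [a] \<preceq> z \<Longrightarrow> z \<preceq> t"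
        using IH[OF a(2,1)] by blast
      have ya: "y \<otimes>\<^bsub>M\<^esub> el [a] \<in> carrier M" using y a by simp
      have yat: "y \<otimes>\<^bsub>M\<^esub> el [a] \<preceq> t" using t(2)[OF a(2)] ya by simp
      have "z \<preceq> t" if z: "?P z" "y \<preceq> z" for z
      proof (cases "z = y")
        case True
        then show ?thesis using dvdM_trans[OF dvdM_mult yat] y a by simp
      next
        case False
        then obtain b Z where b: "b \<in> S" "Z \<in> lists S" "z = y \<otimes>\<^bsub>M\<^esub> el (b # Z)"
          using cases[OF z(2) y] by blast
        note yb = step[OF z(1) b(3) y b(1,2)] and ybz = dv[OF z(1) b(3) y b(1,2)]
        have ybc: "y \<otimes>\<^bsub>M\<^esub> el [b] \<in> carrier M" using y b by simp
        show ?thesis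
        proof (cases "b = a")
          case True
          then show ?thesis using t(2)[OF z(1)] ybz by simp
        next
          case False
          obtain d where d: "d \<in> carrier M" "d \<preceq> x" "w \<otimes>\<^bsub>M\<^esub> d \<in> Red"
            "y \<otimes>\<^bsub>M\<^esub> el [a] \<preceq> d" "y \<otimes>\<^bsub>M\<^esub> el [b] \<preceq> d"
            using Red_join[OF Red_carrier[OF w] x y a(1) b(1), of thesis] False a(2) yb
            unfolding completion_def by blast
          then have Pd: "?P d" by (simp add: completion_def)
          \<comment> \<open>The maxima \<open>t\<close> above \<open>y a\<close> and \<open>t'\<close> above \<open>y b\<close> both lie above the common upper bound \<open>d\<close>, so each
            divides the other.\<close>
          obtain t' where t': "?P t'" "\<And>z. ?P z \<Longrightarrow> y \<otimes>\<^bsub>M\<^esub> el [b] \<preceq> z \<Longrightarrow> z \<preceq> t'"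
            using IH[OF yb b(1)] by blast
          have "y \<otimes>\<^bsub>M\<^esub> el [b] \<preceq> t" using dvdM_trans[OF d(5) t(2)[OF Pd d(4)] ybc] .
          then have "t \<preceq> t'" using t'(2) t(1) by blast
          then have "y \<otimes>\<^bsub>M\<^esub> el [a] \<preceq> t'" using dvdM_trans[OF yat] ya by blast
          then have "t' \<preceq> t" using t(2) t'(1) by blast
          moreover have "z \<preceq> t'" using t'(2)[OF z(1) ybz] .
          ultimately show ?thesis using dvdM_trans carr[OF z(1)] by blast
        qed
      qed
      then show ?thesis using t(1) by blast
    qed
  qed
  have "?P \<one>\<^bsub>M\<^esub>" using w x Red_carrier by (auto simp: completion_def factor_def)
  then obtain t where "?P t" "\<forall>z. ?P z \<and> \<one>\<^bsub>M\<^esub> \<preceq> z \<longrightarrow> z \<preceq> t"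
    using max_above by metis
  moreover have "\<one>\<^bsub>M\<^esub> \<preceq> z" if "?P z" for z using carr[OF that] by (auto simp: factor_def)
  ultimately show ?thesis by metis
qed

definition max_completion :: "'a list set \<Rightarrow> 'a list set \<Rightarrow> 'a list set"
  where "max_completion w x = (SOME y. completion w x y \<and> (\<forall>z. completion w x z \<longrightarrow> z \<preceq> y))"

lemma max_completion:
  assumes "w \<in> Red" "x \<in> Red"
  shows "completion w x (max_completion w x)"
    and "completion w x z \<Longrightarrow> z \<preceq> max_completion w x"
  using someI_ex[OF completion_maximum_exists[OF assms]] unfolding max_completion_def by blast+

lemma max_completion_eqI:
  assumes "w \<in> Red" "x \<in> Red" "completion w x y" "\<And>z. completion w x z \<Longrightarrow> z \<preceq> y"
  shows "max_completion w x = y"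
  using max_completion[OF assms(1,2)] assms(3,4)
  by (intro dvdM_antisym) (auto simp: completion_def)

definition greedy :: "'a list set \<Rightarrow> 'a list set \<Rightarrow> 'a list set"
  where "greedy w x = w \<otimes>\<^bsub>M\<^esub> max_completion w x"

lemma greedy_Red: "w \<in> Red \<Longrightarrow> x \<in> Red \<Longrightarrow> greedy w x \<in> Red"
  using max_completion(1) by (simp add: greedy_def completion_def)

lemma greedy_one: assumes x: "x \<in> Red" shows "greedy \<one>\<^bsub>M\<^esub> x = x"
proof -
  have c: "x \<in> carrier M" using Red_carrier x .
  have "max_completion \<one>\<^bsub>M\<^esub> x = x"
    by (rule max_completion_eqI[OF one_Red x]) (use c x in \<open>auto simp: completion_def\<close>)
  then show ?thesis using c by (simp add: greedy_def)
qed

text \<open>If \<open>v\<close> completes \<open>w w'\<close> then it completes \<open>w'\<close>, and \<open>w' v\<close> completes \<open>w\<close>. Conversely \<open>w'\<close> itself is a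
  completion of \<open>w\<close>, so the largest completion of \<open>w\<close> in \<open>greedy w' x\<close> begins with \<open>w'\<close>, and what
  remains completes \<open>w w'\<close>.\<close>
lemma greedy_greedy:
  assumes w: "w \<in> carrier M" and w': "w' \<in> carrier M" and ww': "w \<otimes>\<^bsub>M\<^esub> w' \<in> Red" and x: "x \<in> Red"
  shows "greedy w (greedy w' x) = greedy (w \<otimes>\<^bsub>M\<^esub> w') x"
proof -
  have r: "w \<in> Red" "w' \<in> Red" using Red_factors[OF w w' ww'] .
  define y where "y = max_completion w' x"
  have y: "y \<in> carrier M" "y \<preceq> x" "w' \<otimes>\<^bsub>M\<^esub> y \<in> Red"
    using max_completion(1)[OF r(2) x] unfolding y_def completion_def by auto
  define z where "z = max_completion w (w' \<otimes>\<^bsub>M\<^esub> y)"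
  have z: "z \<in> carrier M" "z \<preceq> w' \<otimes>\<^bsub>M\<^esub> y" "w \<otimes>\<^bsub>M\<^esub> z \<in> Red"
    using max_completion(1)[OF r(1) y(3)] unfolding z_def completion_def by auto
  have zmax: "v \<preceq> z" if "v \<in> carrier M" "v \<preceq> w' \<otimes>\<^bsub>M\<^esub> y" "w \<otimes>\<^bsub>M\<^esub> v \<in> Red" for v
    using max_completion(2)[OF r(1) y(3)] that unfolding z_def completion_def by auto
  have "w' \<preceq> z" using zmax[OF w' dvdM_mult[OF w' y(1)] ww'] .
  then obtain z' where z': "z' \<in> carrier M" "z = w' \<otimes>\<^bsub>M\<^esub> z'" unfolding factor_def by blast
  obtain e where e: "e \<in> carrier M" "w' \<otimes>\<^bsub>M\<^esub> y = z \<otimes>\<^bsub>M\<^esub> e" using z(2) unfolding factor_def by blast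
  have "w' \<otimes>\<^bsub>M\<^esub> y = w' \<otimes>\<^bsub>M\<^esub> (z' \<otimes>\<^bsub>M\<^esub> e)"
    unfolding e(2) z'(2) by (rule M.m_assoc[OF w' z'(1) e(1)])
  then have "y = z' \<otimes>\<^bsub>M\<^esub> e"
    by (rule Red_cancel[OF w' y(1) M.m_closed[OF z'(1) e(1)] y(3)])
  then have z'y: "z' \<preceq> y" using e(1) unfolding factor_def by blast
  have "max_completion (w \<otimes>\<^bsub>M\<^esub> w') x = z'"
  proof (rule max_completion_eqI[OF ww' x])
    show "completion (w \<otimes>\<^bsub>M\<^esub> w') x z'"
      using z' z w w' dvdM_trans[OF z'y y(2)] by (simp add: completion_def M.m_assoc)
    fix v assume v: "completion (w \<otimes>\<^bsub>M\<^esub> w') x v"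
    then have vc: "v \<in> carrier M" by (simp add: completion_def)
    have wv: "w \<otimes>\<^bsub>M\<^esub> (w' \<otimes>\<^bsub>M\<^esub> v) \<in> Red"
      using v M.m_assoc[OF w w' vc] by (simp add: completion_def)
    then have w'v: "w' \<otimes>\<^bsub>M\<^esub> v \<in> Red" using Red_factors(2)[OF w M.m_closed[OF w' vc]] by simp
    then have "v \<preceq> y"
      using max_completion(2)[OF r(2) x] v unfolding y_def completion_def by simp
    then have "w' \<otimes>\<^bsub>M\<^esub> v \<preceq> z" using zmax[of "w' \<otimes>\<^bsub>M\<^esub> v"] dvdM_mult_left[of v y w'] w' vc wv by simp
    then obtain f where f: "f \<in> carrier M" "w' \<otimes>\<^bsub>M\<^esub> z' = w' \<otimes>\<^bsub>M\<^esub> v \<otimes>\<^bsub>M\<^esub> f"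
      using z' unfolding factor_def by auto
    have "w' \<otimes>\<^bsub>M\<^esub> z' \<in> Red" using z'(2) z(3) Red_factors(2)[OF w z(1)] by simp
    moreover have "w' \<otimes>\<^bsub>M\<^esub> z' = w' \<otimes>\<^bsub>M\<^esub> (v \<otimes>\<^bsub>M\<^esub> f)"
      unfolding f(2) by (rule M.m_assoc[OF w' vc f(1)])
    ultimately have "z' = v \<otimes>\<^bsub>M\<^esub> f"
      by (rule Red_cancel[OF w' z'(1) M.m_closed[OF vc f(1)]])
    then show "v \<preceq> z'" using f(1) unfolding factor_def by blast
  qed
  moreover have "greedy w (greedy w' x) = w \<otimes>\<^bsub>M\<^esub> (w' \<otimes>\<^bsub>M\<^esub> z')"
    using z'(2) by (simp add: greedy_def y_def z_def)
  ultimately show ?thesis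
    using M.m_assoc[OF w w' z'(1)] by (simp add: greedy_def)
qed

section \<open>The largest reduced divisor\<close>

text \<open>The value of \<open>\<alpha>\<close> at the element represented by the word, see \<open>alpha_el\<close>.\<close>
definition greedy_fold :: "'a list \<Rightarrow> 'a list set"
  where "greedy_fold w = foldr (\<lambda>s. greedy (el [s])) w \<one>\<^bsub>M\<^esub>"

lemma greedy_fold_Cons: "greedy_fold (s # w) = greedy (el [s]) (greedy_fold w)"
  by (simp add: greedy_fold_def)

lemma greedy_fold_Red: "w \<in> lists S \<Longrightarrow> greedy_fold w \<in> Red"
  by (induction w) (simp_all add: greedy_fold_def one_Red greedy_Red gen_Red)

lemma greedy_fold_append: "red w \<Longrightarrow> u \<in> lists S \<Longrightarrow> greedy_fold (w @ u) = greedy (el w) (greedy_fold u)"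
proof (induction w)
  case Nil
  then show ?case using greedy_one greedy_fold_Red by (simp flip: one_el)
next
  case (Cons s w)
  have r: "s \<in> S" "red w" "w \<in> lists S" using Cons.prems(1) red_ConsD red_lists by auto
  have "greedy_fold ((s # w) @ u) = greedy (el [s]) (greedy (el w) (greedy_fold u))"
    using Cons.IH[OF r(2) Cons.prems(2)] by (simp add: greedy_fold_Cons)
  also have "\<dots> = greedy (el [s] \<otimes>\<^bsub>M\<^esub> el w) (greedy_fold u)"
    using r greedy_fold_Red[OF Cons.prems(2)] Cons.prems(1) el_Red_iff[of "s # w"]
    by (intro greedy_greedy) (simp_all add: el_mult)
  finally show ?case using r by (simp add: el_mult)
qed

lemma red_alt_word: assumes ab: "a \<in> S" "b \<in> S" and n: "m a b = enat n"
  shows "red (alt_word a b n)"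
proof -
  have s: "red [c]" if "c \<in> S" for c using gen_Red[OF that] el_Red_iff[of "[c]"] that by simp
  show ?thesis
  proof (cases "a = b")
    case True
    then show ?thesis using n diagonal[OF ab(1)] s[OF ab(1)] by (simp add: one_enat_def)
  next
    case False
    then show ?thesis using two_ascents[of a "[]" b n] s ab n by simp
  qed
qed

text \<open>Both sides of a defining relation are reduced words for the same element, so by
  \<open>greedy_fold_append\<close> they act in the same way.\<close>
lemma greedy_fold_cong:
  assumes "x \<simeq> y" "u \<in> lists S"
  shows "greedy_fold (x @ u) = greedy_fold (y @ u)"
  using assms unfolding eqA_def
proof (induction arbitrary: u rule: gen_cong.induct)
  case (base x y)
  then obtain a b n where ab: "a \<in> S" "b \<in> S" "m a b = enat n" and
    xy: "x = alt_word a b n" "y = alt_word b a n"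
    by (auto simp: artin_rels_def)
  have "red x" "red y" using red_alt_word ab symmetric xy by metis+
  moreover have "el x = el y" using eqA_braid[OF ab] xy el_eqI by simp
  ultimately show ?case using greedy_fold_append base.prems by simp
next
  case (append x y x' y')
  have l: "x' @ u \<in> lists S" "y \<in> lists S"
    using append.hyps append.prems artin.gen_cong_in_lists by auto
  have "greedy_fold (x @ x' @ u) = greedy_fold (y @ x' @ u)" by (rule append.IH(1)[OF l(1)])
  also have "\<dots> = greedy_fold (y @ y' @ u)"
    using append.IH(2)[OF append.prems] by (simp add: greedy_fold_def)
  finally show ?case by simp
qed simp_all

lemma greedy_fold_divides: "w \<in> lists S \<Longrightarrow> greedy_fold w \<preceq> el w"
proof (induction w)
  case Nil
  then show ?case by (simp add: greedy_fold_def one_el[symmetric])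
next
  case (Cons s w)
  then have l: "s \<in> S" "w \<in> lists S" by auto
  let ?y = "max_completion (el [s]) (greedy_fold w)"
  have c: "completion (el [s]) (greedy_fold w) ?y"
    using max_completion(1) gen_Red[OF l(1)] greedy_fold_Red[OF l(2)] .
  then have y: "?y \<in> carrier M" "?y \<preceq> greedy_fold w" by (simp_all add: completion_def)
  have "?y \<preceq> el w" using dvdM_trans[OF y(2) Cons.IH y(1)] l by simp
  then have "el [s] \<otimes>\<^bsub>M\<^esub> ?y \<preceq> el [s] \<otimes>\<^bsub>M\<^esub> el w" using y l by (intro dvdM_mult_left) auto
  then show ?case using l by (simp add: greedy_fold_Cons greedy_def el_mult)
qed

text \<open>Write \<open>el w = v z\<close>. By invariance the fold may be computed along a word of \<open>v\<close> followed by one of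
  \<open>z\<close>, and \<open>greedy v\<close> has values divisible by \<open>v\<close>.\<close>
lemma divides_greedy_fold:
  assumes w: "w \<in> lists S" and v: "v \<in> Red" "v \<preceq> el w"
  shows "v \<preceq> greedy_fold w"
proof -
  obtain z where z: "z \<in> carrier M" "el w = v \<otimes>\<^bsub>M\<^esub> z" using v(2) unfolding factor_def by blast
  obtain V Z where l: "V \<in> lists S" "Z \<in> lists S" "v = el V" "z = el Z"
    using z(1) Red_carrier[OF v(1)] by (metis carrier_el)
  then have "w \<simeq> V @ Z" using z(2) w by (simp add: el_mult el_eq_iff)
  then have "greedy_fold w = greedy_fold (V @ Z)" using greedy_fold_cong[of w "V @ Z" "[]"] by simp
  also have "\<dots> = greedy v (greedy_fold Z)" using l v(1) el_Red_iff greedy_fold_append by simp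
  also have "v \<preceq> \<dots>"
    using max_completion(1)[OF v(1) greedy_fold_Red[OF l(2)]] v(1) Red_carrier
    unfolding greedy_def completion_def by (intro dvdM_mult) auto
  finally show ?thesis .
qed

text \<open>Maximality in the definition of \<open>alpha\<close> only excludes proper multiples. It picks out the
  greatest element once there is one.\<close>
lemma alpha_eqI:
  assumes u: "u \<in> carrier M" and a: "a \<in> Red" "a \<preceq> u" and max: "\<And>v. v \<in> Red \<Longrightarrow> v \<preceq> u \<Longrightarrow> v \<preceq> a"
  shows "alpha S m u = a"
  unfolding alpha_def
proof (rule the_equality)
  show "a \<in> red_divisors S m u \<and> (\<forall>w\<in>red_divisors S m u. a \<preceq> w \<longrightarrow> w = a)"
    using a max Red_carrier dvdM_antisym unfolding red_divisors_def by blast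
  fix v assume "v \<in> red_divisors S m u \<and> (\<forall>w\<in>red_divisors S m u. v \<preceq> w \<longrightarrow> w = v)"
  then show "v = a" using a max unfolding red_divisors_def by blast
qed

lemma alpha_el: "w \<in> lists S \<Longrightarrow> alpha S m (el w) = greedy_fold w"
  using alpha_eqI greedy_fold_Red greedy_fold_divides divides_greedy_fold by simp

abbreviation \<alpha> where "\<alpha> \<equiv> alpha S m"

lemma alpha_Red: "u \<in> carrier M \<Longrightarrow> \<alpha> u \<in> Red"
  and alpha_divides: "u \<in> carrier M \<Longrightarrow> \<alpha> u \<preceq> u"
  and divides_alpha: "u \<in> carrier M \<Longrightarrow> v \<in> Red \<Longrightarrow> v \<preceq> u \<Longrightarrow> v \<preceq> \<alpha> u"
  using alpha_el greedy_fold_Red greedy_fold_divides divides_greedy_fold by (metis carrier_el)+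

lemma alpha_carrier [simp]: "u \<in> carrier M \<Longrightarrow> \<alpha> u \<in> carrier M"
  using alpha_Red Red_carrier by blast

lemma alpha_of_Red: "u \<in> Red \<Longrightarrow> \<alpha> u = u"
  by (rule alpha_eqI) (simp_all add: Red_carrier)

lemma alpha_gen_mult:
  assumes a: "a \<in> S" and z: "z \<in> carrier M"
  obtains D where "D \<in> carrier M" "D \<preceq> z" "\<alpha> (el [a] \<otimes>\<^bsub>M\<^esub> z) = el [a] \<otimes>\<^bsub>M\<^esub> D"
proof -
  obtain w where w: "w \<in> lists S" "z = el w" using z by (rule carrier_el)
  have c: "completion (el [a]) (greedy_fold w) (max_completion (el [a]) (greedy_fold w))"
    using max_completion(1) gen_Red[OF a] greedy_fold_Red[OF w(1)] .
  have "\<alpha> (el [a] \<otimes>\<^bsub>M\<^esub> z) = el [a] \<otimes>\<^bsub>M\<^esub> max_completion (el [a]) (greedy_fold w)"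
    using a w by (simp add: el_mult alpha_el greedy_fold_Cons greedy_def)
  then show ?thesis
    using that c greedy_fold_divides[OF w(1)] dvdM_trans w(2) unfolding completion_def by blast
qed

lemma alpha_mult:
  assumes u: "u \<in> carrier M" and v: "v \<in> carrier M"
  shows "\<alpha> (u \<otimes>\<^bsub>M\<^esub> v) = \<alpha> (u \<otimes>\<^bsub>M\<^esub> \<alpha> v)"
proof -
  obtain U V where l: "U \<in> lists S" "V \<in> lists S" "u = el U" "v = el V"
    using u v by (metis carrier_el)
  obtain V' where V': "V' \<in> lists S" "\<alpha> v = el V'" using alpha_carrier[OF v] by (metis carrier_el)
  have "greedy_fold V' = \<alpha> (el V')" using alpha_el V'(1) by simp
  also have "\<dots> = el V'" using alpha_of_Red alpha_Red[OF v] V'(2) by simp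
  also have "\<dots> = greedy_fold V" using V'(2) alpha_el l by simp
  finally have "greedy_fold (U @ V') = greedy_fold (U @ V)" by (simp add: greedy_fold_def)
  then show ?thesis using l V' by (simp add: el_mult alpha_el)
qed

section \<open>Left cancellation\<close>

text \<open>Two factorizations \<open>a z = b z'\<close> of an element are linked if their equality is visible inside a
  reduced left divisor. For \<open>a = b\<close> this forces \<open>z = z'\<close>, because reduced elements cancel.\<close>
definition linked :: "'a \<Rightarrow> 'a list set \<Rightarrow> 'a \<Rightarrow> 'a list set \<Rightarrow> bool"
  where "linked a z b z' \<longleftrightarrow> (\<exists>x\<in>carrier M. \<exists>y\<in>carrier M. \<exists>q\<in>carrier M.
    el [a] \<otimes>\<^bsub>M\<^esub> x \<in> Red \<and> el [a] \<otimes>\<^bsub>M\<^esub> x = el [b] \<otimes>\<^bsub>M\<^esub> y \<and> z = x \<otimes>\<^bsub>M\<^esub> q \<and> z' = y \<otimes>\<^bsub>M\<^esub> q)"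

definition cancel_upto :: "nat \<Rightarrow> bool"
  where "cancel_upto N \<longleftrightarrow> (\<forall>s\<in>S. \<forall>y\<in>carrier M. \<forall>z\<in>carrier M.
    Suc (artin_length y) \<le> N \<and> el [s] \<otimes>\<^bsub>M\<^esub> y = el [s] \<otimes>\<^bsub>M\<^esub> z \<longrightarrow> y = z)"

lemma cancel_upto_mult:
  assumes N: "cancel_upto N" and x: "x \<in> carrier M"
  shows "y \<in> carrier M \<Longrightarrow> z \<in> carrier M \<Longrightarrow> artin_length (x \<otimes>\<^bsub>M\<^esub> y) \<le> N \<Longrightarrow>
    x \<otimes>\<^bsub>M\<^esub> y = x \<otimes>\<^bsub>M\<^esub> z \<Longrightarrow> y = z"
proof -
  obtain X where X: "X \<in> lists S" "x = el X" using x by (rule carrier_el)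
  have "y = z" if "y \<in> carrier M" "z \<in> carrier M" "length X + artin_length y \<le> N"
    "el X \<otimes>\<^bsub>M\<^esub> y = el X \<otimes>\<^bsub>M\<^esub> z" for y z
    using X(1) that
  proof (induction X)
    case Nil
    then show ?case by (simp flip: one_el)
  next
    case (Cons s X)
    then have l: "s \<in> S" "X \<in> lists S" by auto
    have split: "el (s # X) \<otimes>\<^bsub>M\<^esub> v = el [s] \<otimes>\<^bsub>M\<^esub> (el X \<otimes>\<^bsub>M\<^esub> v)" if "v \<in> carrier M" for v
      using M.m_assoc[of "el [s]" "el X" v] that l by (simp add: el_mult)
    have eq: "el [s] \<otimes>\<^bsub>M\<^esub> (el X \<otimes>\<^bsub>M\<^esub> y) = el [s] \<otimes>\<^bsub>M\<^esub> (el X \<otimes>\<^bsub>M\<^esub> z)"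
      using Cons.prems split by simp
    have len: "Suc (artin_length (el X \<otimes>\<^bsub>M\<^esub> y)) \<le> N"
      using Cons.prems l by (simp add: artin_length_mult)
    have c: "el X \<otimes>\<^bsub>M\<^esub> y \<in> carrier M" "el X \<otimes>\<^bsub>M\<^esub> z \<in> carrier M"
      using l Cons.prems by simp_all
    have "el X \<otimes>\<^bsub>M\<^esub> y = el X \<otimes>\<^bsub>M\<^esub> z"
      by (rule N[unfolded cancel_upto_def, rule_format, OF l(1) c conjI[OF len eq]])
    then show ?case using Cons.IH l Cons.prems by simp
  qed
  then show "y \<in> carrier M \<Longrightarrow> z \<in> carrier M \<Longrightarrow> artin_length (x \<otimes>\<^bsub>M\<^esub> y) \<le> N \<Longrightarrow>
    x \<otimes>\<^bsub>M\<^esub> y = x \<otimes>\<^bsub>M\<^esub> z \<Longrightarrow> y = z"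
    using X x by (simp add: artin_length_mult)
qed

lemma linked_refl: "a \<in> S \<Longrightarrow> z \<in> carrier M \<Longrightarrow> linked a z a z"
  unfolding linked_def using gen_Red
  by (intro bexI[of _ "\<one>\<^bsub>M\<^esub>"] bexI[of _ z]) auto

lemma linked_sym: "linked a z b z' \<Longrightarrow> linked b z' a z"
  unfolding linked_def by metis

lemma linked_mult:
  assumes l: "linked a z b z'" and v: "v \<in> carrier M"
  shows "linked a (z \<otimes>\<^bsub>M\<^esub> v) b (z' \<otimes>\<^bsub>M\<^esub> v)"
proof -
  obtain x y q where "x \<in> carrier M" "y \<in> carrier M" "q \<in> carrier M" "el [a] \<otimes>\<^bsub>M\<^esub> x \<in> Red"
    "el [a] \<otimes>\<^bsub>M\<^esub> x = el [b] \<otimes>\<^bsub>M\<^esub> y" "z = x \<otimes>\<^bsub>M\<^esub> q" "z' = y \<otimes>\<^bsub>M\<^esub> q"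
    using l unfolding linked_def by blast
  then show ?thesis
    unfolding linked_def using v M.m_assoc M.m_closed[of q v] by blast
qed

text \<open>Both links provide reduced divisors of \<open>b z'\<close>. They divide \<open>\<alpha>(b z') = b D\<close>, and \<open>D\<close> divides \<open>z'\<close>
  since \<open>\<alpha>\<close> of a product is a greedy extension; so both links can be rewritten with \<open>b D\<close> as the reduced
  divisor. The rewriting cancels only in \<open>z'\<close>, which is shorter than the elements that are
  being compared.\<close>
lemma linked_trans:
  assumes N: "cancel_upto N" and len: "artin_length z' \<le> N"
    and S: "a \<in> S" "b \<in> S" "c \<in> S"
    and l1: "linked a z b z'" and l2: "linked b z' c z''"
  shows "linked a z c z''"
proof -
  obtain x1 y1 q where 1: "x1 \<in> carrier M" "y1 \<in> carrier M" "q \<in> carrier M" "el [a] \<otimes>\<^bsub>M\<^esub> x1 \<in> Red"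
    "el [a] \<otimes>\<^bsub>M\<^esub> x1 = el [b] \<otimes>\<^bsub>M\<^esub> y1" "z = x1 \<otimes>\<^bsub>M\<^esub> q" "z' = y1 \<otimes>\<^bsub>M\<^esub> q"
    using l1 unfolding linked_def by blast
  obtain y2 x2 q' where 2: "y2 \<in> carrier M" "x2 \<in> carrier M" "q' \<in> carrier M" "el [b] \<otimes>\<^bsub>M\<^esub> y2 \<in> Red"
    "el [b] \<otimes>\<^bsub>M\<^esub> y2 = el [c] \<otimes>\<^bsub>M\<^esub> x2" "z' = y2 \<otimes>\<^bsub>M\<^esub> q'" "z'' = x2 \<otimes>\<^bsub>M\<^esub> q'"
    using l2 unfolding linked_def by blast
  have g: "el [a] \<in> carrier M" "el [b] \<in> carrier M" "el [c] \<in> carrier M" using S by simp_all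
  have z': "z' \<in> carrier M" using 1 by simp
  obtain D where D: "D \<in> carrier M" "D \<preceq> z'" "\<alpha> (el [b] \<otimes>\<^bsub>M\<^esub> z') = el [b] \<otimes>\<^bsub>M\<^esub> D"
    using alpha_gen_mult[OF S(2) z'] .
  have bz': "el [b] \<otimes>\<^bsub>M\<^esub> z' \<in> carrier M" using g z' by simp
  have DR: "el [b] \<otimes>\<^bsub>M\<^esub> D \<in> Red" using alpha_Red[OF bz'] D(3) by simp
  obtain p where p: "p \<in> carrier M" "z' = D \<otimes>\<^bsub>M\<^esub> p" using D(2) unfolding factor_def by blast
  \<comment> \<open>A reduced divisor \<open>b y\<close> of \<open>b z'\<close> extends to \<open>b D\<close>, compatibly with the cofactors in \<open>z'\<close>.\<close>
  have part: "\<exists>d\<in>carrier M. D = y \<otimes>\<^bsub>M\<^esub> d \<and> r = d \<otimes>\<^bsub>M\<^esub> p"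
    if y: "y \<in> carrier M" and r: "r \<in> carrier M" and yr: "z' = y \<otimes>\<^bsub>M\<^esub> r" and R: "el [b] \<otimes>\<^bsub>M\<^esub> y \<in> Red" for y r
  proof -
    have "el [b] \<otimes>\<^bsub>M\<^esub> y \<preceq> el [b] \<otimes>\<^bsub>M\<^esub> z'"
      using dvdM_mult_left[of y z' "el [b]"] dvdM_I[OF yr r] g(2) y by simp
    then have "el [b] \<otimes>\<^bsub>M\<^esub> y \<preceq> el [b] \<otimes>\<^bsub>M\<^esub> D" using divides_alpha[OF bz' R] D(3) by simp
    then obtain d where d: "d \<in> carrier M" "el [b] \<otimes>\<^bsub>M\<^esub> D = el [b] \<otimes>\<^bsub>M\<^esub> y \<otimes>\<^bsub>M\<^esub> d"
      unfolding factor_def by blast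
    have "el [b] \<otimes>\<^bsub>M\<^esub> D = el [b] \<otimes>\<^bsub>M\<^esub> (y \<otimes>\<^bsub>M\<^esub> d)"
      unfolding d(2) by (rule M.m_assoc[OF g(2) y d(1)])
    then have Dd: "D = y \<otimes>\<^bsub>M\<^esub> d" by (rule Red_cancel[OF g(2) D(1) M.m_closed[OF y d(1)] DR])
    have "y \<otimes>\<^bsub>M\<^esub> r = y \<otimes>\<^bsub>M\<^esub> (d \<otimes>\<^bsub>M\<^esub> p)"
      using yr p(2) Dd M.m_assoc[OF y d(1) p(1)] by simp
    then have "r = d \<otimes>\<^bsub>M\<^esub> p"
      using cancel_upto_mult[OF N y r M.m_closed[OF d(1) p(1)]] len yr by simp
    with Dd d(1) show ?thesis by blast
  qed
  obtain d where d: "d \<in> carrier M" "D = y1 \<otimes>\<^bsub>M\<^esub> d" "q = d \<otimes>\<^bsub>M\<^esub> p"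
    using part[OF 1(2,3,7)] 1(4,5) by auto
  obtain d' where d': "d' \<in> carrier M" "D = y2 \<otimes>\<^bsub>M\<^esub> d'" "q' = d' \<otimes>\<^bsub>M\<^esub> p"
    using part[OF 2(1,3,6)] 2(4) by auto
  have "el [a] \<otimes>\<^bsub>M\<^esub> (x1 \<otimes>\<^bsub>M\<^esub> d) = el [b] \<otimes>\<^bsub>M\<^esub> y1 \<otimes>\<^bsub>M\<^esub> d"
    using M.m_assoc[OF g(1) 1(1) d(1)] 1(5) by simp
  also have "\<dots> = el [b] \<otimes>\<^bsub>M\<^esub> D" using M.m_assoc[OF g(2) 1(2) d(1)] d(2) by simp
  finally have e1: "el [a] \<otimes>\<^bsub>M\<^esub> (x1 \<otimes>\<^bsub>M\<^esub> d) = el [b] \<otimes>\<^bsub>M\<^esub> D" .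
  have "el [c] \<otimes>\<^bsub>M\<^esub> (x2 \<otimes>\<^bsub>M\<^esub> d') = el [b] \<otimes>\<^bsub>M\<^esub> y2 \<otimes>\<^bsub>M\<^esub> d'"
    using M.m_assoc[OF g(3) 2(2) d'(1)] 2(5) by simp
  also have "\<dots> = el [b] \<otimes>\<^bsub>M\<^esub> D" using M.m_assoc[OF g(2) 2(1) d'(1)] d'(2) by simp
  finally have e2: "el [c] \<otimes>\<^bsub>M\<^esub> (x2 \<otimes>\<^bsub>M\<^esub> d') = el [b] \<otimes>\<^bsub>M\<^esub> D" .
  have "z = x1 \<otimes>\<^bsub>M\<^esub> d \<otimes>\<^bsub>M\<^esub> p" using 1(6) d(3) M.m_assoc[OF 1(1) d(1) p(1)] by simp
  moreover have "z'' = x2 \<otimes>\<^bsub>M\<^esub> d' \<otimes>\<^bsub>M\<^esub> p" using 2(7) d'(3) M.m_assoc[OF 2(2) d'(1) p(1)] by simp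
  moreover have "x1 \<otimes>\<^bsub>M\<^esub> d \<in> carrier M" "x2 \<otimes>\<^bsub>M\<^esub> d' \<in> carrier M" using 1(1) 2(2) d d' by simp_all
  moreover have "el [a] \<otimes>\<^bsub>M\<^esub> (x1 \<otimes>\<^bsub>M\<^esub> d) \<in> Red" using e1 DR by simp
  moreover have "el [a] \<otimes>\<^bsub>M\<^esub> (x1 \<otimes>\<^bsub>M\<^esub> d) = el [c] \<otimes>\<^bsub>M\<^esub> (x2 \<otimes>\<^bsub>M\<^esub> d')" using e1 e2 by simp
  ultimately show ?thesis using p(1) unfolding linked_def by blast
qed

text \<open>Any two words of an element are joined by braid moves. A move inside the tails changes no link, a
  move at the front is a link by definition, and links compose.\<close>
lemma linked_words:
  assumes "x \<simeq> y" "length x \<le> Suc N" "cancel_upto N"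
  shows "x = [] \<and> y = [] \<or> x \<noteq> [] \<and> y \<noteq> [] \<and> linked (hd x) (el (tl x)) (hd y) (el (tl y))"
  using assms unfolding eqA_def
proof (induction rule: gen_cong.induct)
  case (base x y)
  then obtain a b n where ab: "a \<in> S" "b \<in> S" "m a b = enat n" and
    xy: "x = alt_word a b n" "y = alt_word b a n"
    by (auto simp: artin_rels_def)
  show ?case
  proof (cases n)
    case 0
    then show ?thesis using xy by simp
  next
    case (Suc n')
    have c: "el (alt_word b a n') \<in> carrier M" "el (alt_word a b n') \<in> carrier M"
      using ab by (simp_all add: alt_word_lists)
    have "el [a] \<otimes>\<^bsub>M\<^esub> el (alt_word b a n') = el x" "el [b] \<otimes>\<^bsub>M\<^esub> el (alt_word a b n') = el y"
      using ab xy Suc by (simp_all add: el_mult alt_word_lists)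
    moreover have "el x = el y" using eqA_braid[OF ab] xy el_eqI by simp
    moreover have "el x \<in> Red" using red_alt_word[OF ab] xy el_Red_iff red_lists by blast
    ultimately have "linked a (el (alt_word b a n')) b (el (alt_word a b n'))"
      unfolding linked_def using c
      by (intro bexI[of _ "el (alt_word b a n')"] bexI[of _ "el (alt_word a b n')"]
          bexI[of _ "\<one>\<^bsub>M\<^esub>"]) auto
    then show ?thesis using xy Suc by simp
  qed
next
  case (refl x)
  then show ?case by (cases x) (auto intro!: linked_refl el_carrier)
next
  case (sym x y)
  have "length x = length y" using eqA_length sym.hyps unfolding eqA_def by blast
  then show ?case using sym linked_sym by auto
next
  case (trans x y z)
  have len: "length x = length y" "length y = length z"
    using eqA_length trans.hyps unfolding eqA_def by blast+
  have l: "x \<in> lists S" "y \<in> lists S" "z \<in> lists S"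
    using artin.gen_cong_in_lists trans.hyps by blast+
  show ?case
  proof (cases y)
    case Nil
    then show ?thesis using len by simp
  next
    case (Cons b y')
    then obtain a x' c z' where xz: "x = a # x'" "z = c # z'" using len
      by (metis length_0_conv list.exhaust list.distinct(1))
    have "linked a (el x') b (el y')" "linked b (el y') c (el z')"
      using trans.IH trans.prems len Cons xz by simp_all
    moreover have "artin_length (el y') \<le> N" using l(2) Cons trans.prems(1) len by simp
    moreover have "a \<in> S" "b \<in> S" "c \<in> S" using l Cons xz by simp_all
    ultimately have "linked a (el x') c (el z')"
      using linked_trans[OF trans.prems(2)] by blast
    then show ?thesis using xz by simp
  qed
next
  case (append x y x' y')
  have len: "length x = length y" "length x' = length y'"
    using eqA_length append.hyps unfolding eqA_def by blast+
  have l: "x \<in> lists S" "y \<in> lists S" "x' \<in> lists S" "y' \<in> lists S"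
    using artin.gen_cong_in_lists append.hyps by blast+
  show ?case
  proof (cases x)
    case Nil
    then show ?thesis using append.IH(2) append.prems len by simp
  next
    case (Cons a t)
    then obtain b u where y: "y = b # u" using len by (metis length_0_conv list.exhaust list.distinct(1))
    have "linked a (el t) b (el u)" using append.IH(1) append.prems Cons y by simp
    then have "linked a (el t \<otimes>\<^bsub>M\<^esub> el x') b (el u \<otimes>\<^bsub>M\<^esub> el x')" using l by (intro linked_mult) auto
    moreover have "el x' = el y'" using append.hyps(2) el_eqI unfolding eqA_def by blast
    ultimately have "linked a (el t \<otimes>\<^bsub>M\<^esub> el x') b (el u \<otimes>\<^bsub>M\<^esub> el y')" by simp
    then show ?thesis
      using l Cons y el_mult[of t x'] el_mult[of u y'] by simp
  qed
qed

lemma cancel_upto: "cancel_upto N"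
proof (induction N)
  case (Suc N)
  show ?case
    unfolding cancel_upto_def
  proof (intro ballI impI)
    fix s y z
    assume s: "s \<in> S" and y: "y \<in> carrier M" and z: "z \<in> carrier M"
      and e: "Suc (artin_length y) \<le> Suc N \<and> el [s] \<otimes>\<^bsub>M\<^esub> y = el [s] \<otimes>\<^bsub>M\<^esub> z"
    obtain Y Z where l: "Y \<in> lists S" "Z \<in> lists S" "y = el Y" "z = el Z"
      using y z by (metis carrier_el)
    have "s # Y \<simeq> s # Z" using e l s by (simp add: el_mult el_eq_iff)
    moreover have "length (s # Y) \<le> Suc N" using e l by simp
    ultimately have "linked s y s z" using linked_words[OF _ _ Suc.IH, of "s # Y" "s # Z"] l by simp
    then obtain x x' q where x: "x \<in> carrier M" "x' \<in> carrier M" "el [s] \<otimes>\<^bsub>M\<^esub> x \<in> Red"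
      "el [s] \<otimes>\<^bsub>M\<^esub> x = el [s] \<otimes>\<^bsub>M\<^esub> x'" "y = x \<otimes>\<^bsub>M\<^esub> q" "z = x' \<otimes>\<^bsub>M\<^esub> q"
      unfolding linked_def by blast
    have "x = x'" using Red_cancel[OF _ x(1-4)] s by simp
    then show "y = z" using x by simp
  qed
qed (simp add: cancel_upto_def)

theorem left_cancel:
  assumes "x \<in> carrier M" "y \<in> carrier M" "z \<in> carrier M" "x \<otimes>\<^bsub>M\<^esub> y = x \<otimes>\<^bsub>M\<^esub> z"
  shows "y = z"
  using cancel_upto_mult[OF cancel_upto assms(1-3) order.refl assms(4)] .

section \<open>Normal forms and the metric\<close>

definition omega :: "'a list set \<Rightarrow> 'a list set"
  where "omega u = (THE x. x \<in> carrier M \<and> u = \<alpha> u \<otimes>\<^bsub>M\<^esub> x)"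

lemma omega:
  assumes u: "u \<in> carrier M"
  shows omega_carrier: "omega u \<in> carrier M" and alpha_omega: "\<alpha> u \<otimes>\<^bsub>M\<^esub> omega u = u"
proof -
  obtain x where x: "x \<in> carrier M" "u = \<alpha> u \<otimes>\<^bsub>M\<^esub> x"
    using alpha_divides[OF u] unfolding factor_def by blast
  have "\<exists>!x. x \<in> carrier M \<and> u = \<alpha> u \<otimes>\<^bsub>M\<^esub> x"
  proof (rule ex1I)
    show "x \<in> carrier M \<and> u = \<alpha> u \<otimes>\<^bsub>M\<^esub> x" using x by blast
    fix y assume y: "y \<in> carrier M \<and> u = \<alpha> u \<otimes>\<^bsub>M\<^esub> y"
    then have "\<alpha> u \<otimes>\<^bsub>M\<^esub> y = \<alpha> u \<otimes>\<^bsub>M\<^esub> x" using x(2) by metis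
    then show "y = x" using left_cancel[of "\<alpha> u" y x] u x(1) y by simp
  qed
  from theI'[OF this] show "omega u \<in> carrier M" "\<alpha> u \<otimes>\<^bsub>M\<^esub> omega u = u" unfolding omega_def by auto
qed

lemma omega_eqI:
  assumes "u \<in> carrier M" "x \<in> carrier M" "u = \<alpha> u \<otimes>\<^bsub>M\<^esub> x" shows "omega u = x"
proof -
  have "\<alpha> u \<otimes>\<^bsub>M\<^esub> omega u = \<alpha> u \<otimes>\<^bsub>M\<^esub> x" using alpha_omega[OF assms(1)] assms(3) by simp
  then show ?thesis using left_cancel[of "\<alpha> u" "omega u" x] omega_carrier assms by simp
qed

lemma alpha_one: "\<alpha> \<one>\<^bsub>M\<^esub> = \<one>\<^bsub>M\<^esub>" using alpha_of_Red one_Red .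

lemma omega_one: "omega \<one>\<^bsub>M\<^esub> = \<one>\<^bsub>M\<^esub>"
  by (rule omega_eqI) (simp_all add: alpha_one)

lemma alpha_eq_one: assumes u: "u \<in> carrier M" and a: "\<alpha> u = \<one>\<^bsub>M\<^esub>" shows "u = \<one>\<^bsub>M\<^esub>"
proof -
  obtain w where w: "w \<in> lists S" "u = el w" using u by (rule carrier_el)
  show ?thesis
  proof (cases w)
    case Nil
    then show ?thesis using w by (simp add: one_el)
  next
    case (Cons s w')
    have l: "s \<in> S" "w' \<in> lists S" using w Cons by auto
    have "u = el [s] \<otimes>\<^bsub>M\<^esub> el w'" using w l Cons by (simp add: el_mult)
    then have "el [s] \<preceq> u" by (rule dvdM_I) (use l in simp)
    then have "el [s] \<preceq> \<one>\<^bsub>M\<^esub>" using divides_alpha[OF u gen_Red[OF l(1)]] a by simp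
    then obtain c where c: "c \<in> carrier M" "\<one>\<^bsub>M\<^esub> = el [s] \<otimes>\<^bsub>M\<^esub> c" unfolding factor_def by blast
    have "artin_length \<one>\<^bsub>M\<^esub> = 0" using artin_length_0_iff by simp
    then show ?thesis using c l artin_length_mult[of "el [s]" c] by simp
  qed
qed

lemma omega_length: assumes u: "u \<in> carrier M" and n: "u \<noteq> \<one>\<^bsub>M\<^esub>"
  shows "artin_length (omega u) < artin_length u"
proof -
  have "artin_length (\<alpha> u \<otimes>\<^bsub>M\<^esub> omega u) = artin_length (\<alpha> u) + artin_length (omega u)"
    using artin_length_mult u omega_carrier by simp
  moreover have "artin_length (\<alpha> u) \<noteq> 0" using alpha_eq_one[OF u] n u artin_length_0_iff[of "\<alpha> u"] by auto
  ultimately show ?thesis using alpha_omega[OF u] by simp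
qed

definition is_nf :: "'a list set \<Rightarrow> 'a list set list \<Rightarrow> bool"
  where "is_nf u us \<longleftrightarrow> set us \<subseteq> Red - {\<one>\<^bsub>M\<^esub>} \<and> u = list_mult M us \<and>
    (\<forall>i<length us. us ! i = \<alpha> (list_mult M (drop i us)))"

lemma list_mult_simps [simp]: "list_mult M [] = \<one>\<^bsub>M\<^esub>" "list_mult M (x # xs) = x \<otimes>\<^bsub>M\<^esub> list_mult M xs"
  by (simp_all add: list_mult_def)

lemma list_mult_closed: "set us \<subseteq> carrier M \<Longrightarrow> list_mult M us \<in> carrier M"
  by (induction us) auto

lemma is_nf_Nil: "is_nf u [] \<longleftrightarrow> u = \<one>\<^bsub>M\<^esub>"
  by (simp add: is_nf_def)

text \<open>The normal form can be read off from left to right; that the tail is \<open>omega u\<close> is an instance of left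
  cancellation.\<close>
lemma is_nf_Cons:
  assumes u: "u \<in> carrier M"
  shows "is_nf u (a # us) \<longleftrightarrow> u \<noteq> \<one>\<^bsub>M\<^esub> \<and> a = \<alpha> u \<and> is_nf (omega u) us"
proof
  assume nf: "is_nf u (a # us)"
  then have a: "a = \<alpha> u" "u = a \<otimes>\<^bsub>M\<^esub> list_mult M us" "a \<noteq> \<one>\<^bsub>M\<^esub>"
    unfolding is_nf_def by auto
  have c: "list_mult M us \<in> carrier M"
    using nf Red_carrier unfolding is_nf_def by (intro list_mult_closed) auto
  have o: "omega u = list_mult M us" by (rule omega_eqI[OF u c a(2)[unfolded a(1)]])
  have nth: "\<forall>i<length (a # us). (a # us) ! i = \<alpha> (list_mult M (drop i (a # us)))"
    using nf unfolding is_nf_def by blast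
  have "us ! i = \<alpha> (list_mult M (drop i us))" if "i < length us" for i
    using nth[rule_format, of "Suc i"] that by simp
  then have "is_nf (omega u) us" using nf o unfolding is_nf_def by auto
  moreover have "u \<noteq> \<one>\<^bsub>M\<^esub>" using a(1,3) alpha_one by metis
  ultimately show "u \<noteq> \<one>\<^bsub>M\<^esub> \<and> a = \<alpha> u \<and> is_nf (omega u) us" using a(1) by blast
next
  assume r: "u \<noteq> \<one>\<^bsub>M\<^esub> \<and> a = \<alpha> u \<and> is_nf (omega u) us"
  then have p: "u = list_mult M (a # us)" using alpha_omega[OF u] by (auto simp: is_nf_def)
  have "a \<in> Red - {\<one>\<^bsub>M\<^esub>}" using r alpha_Red[OF u] alpha_eq_one[OF u] by auto
  moreover have "(a # us) ! i = \<alpha> (list_mult M (drop i (a # us)))" if "i < length (a # us)" for i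
  proof (cases i)
    case 0
    then show ?thesis using r p by simp
  next
    case (Suc j)
    have "\<forall>i<length us. us ! i = \<alpha> (list_mult M (drop i us))" using r unfolding is_nf_def by blast
    then show ?thesis using that Suc by simp
  qed
  moreover have "set us \<subseteq> Red - {\<one>\<^bsub>M\<^esub>}" using r unfolding is_nf_def by blast
  ultimately show "is_nf u (a # us)" using p unfolding is_nf_def by (metis insert_subset list.set(2))
qed

lemma is_nf_exists: "u \<in> carrier M \<Longrightarrow> \<exists>us. is_nf u us"
proof (induction "artin_length u" arbitrary: u rule: less_induct)
  case less
  show ?case
  proof (cases "u = \<one>\<^bsub>M\<^esub>")
    case True
    then show ?thesis using is_nf_Nil by blast
  next
    case False
    then obtain us where "is_nf (omega u) us"
      using less.hyps[OF omega_length] less.prems omega_carrier by blast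
    then show ?thesis using is_nf_Cons[OF less.prems] False by blast
  qed
qed

lemma is_nf_unique: "u \<in> carrier M \<Longrightarrow> is_nf u us \<Longrightarrow> is_nf u vs \<Longrightarrow> us = vs"
proof (induction us arbitrary: u vs)
  case Nil
  then show ?case using is_nf_Nil is_nf_Cons by (cases vs) auto
next
  case (Cons a us)
  then obtain b vs' where vs: "vs = b # vs'" using is_nf_Nil is_nf_Cons by (cases vs) auto
  have "is_nf (omega u) us" "is_nf (omega u) vs'" "a = b"
    using Cons.prems is_nf_Cons[OF Cons.prems(1)] vs by auto
  then show ?case using Cons.IH[OF omega_carrier[OF Cons.prems(1)]] vs by simp
qed

lemma is_nf_normal_form: assumes u: "u \<in> carrier M" shows "is_nf u (normal_form S m u)"
proof (cases "u = \<one>\<^bsub>M\<^esub>")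
  case True
  then show ?thesis by (simp add: normal_form_def is_nf_Nil)
next
  case False
  then have "normal_form S m u = (THE us. is_nf u us)"
    by (simp add: normal_form_def is_nf_def)
  moreover have "\<exists>!us. is_nf u us" using is_nf_exists is_nf_unique u by blast
  ultimately show ?thesis using theI' by metis
qed

lemma is_nf_nth:
  "u \<in> carrier M \<Longrightarrow> is_nf u us \<Longrightarrow> \<alpha> ((omega ^^ i) u) = (if i < length us then us ! i else \<one>\<^bsub>M\<^esub>)"
proof (induction i arbitrary: u us)
  case 0
  then show ?case using is_nf_Nil is_nf_Cons alpha_one by (cases us) auto
next
  case (Suc i)
  have s: "(omega ^^ Suc i) u = (omega ^^ i) (omega u)" by (simp add: funpow_swap1)
  show ?case
  proof (cases us)
    case Nil
    then have "u = \<one>\<^bsub>M\<^esub>" using is_nf_Nil Suc.prems by simp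
    then have "is_nf (omega u) []" using omega_one is_nf_Nil by simp
    then show ?thesis unfolding s using Suc.IH[OF omega_carrier[OF Suc.prems(1)]] Nil by simp
  next
    case (Cons a vs)
    then have "is_nf (omega u) vs" using is_nf_Cons Suc.prems by blast
    then show ?thesis unfolding s using Suc.IH[OF omega_carrier[OF Suc.prems(1)]] Cons by simp
  qed
qed

text \<open>Past the end of a normal form the entries are \<open>1\<close>, by \<open>is_nf_nth\<close>. With this padding
  agreement makes sense for every \<open>k\<close>, also beyond the ends of the normal forms.\<close>
definition agree :: "nat \<Rightarrow> 'a list set \<Rightarrow> 'a list set \<Rightarrow> bool"
  where "agree k u v \<longleftrightarrow> (\<forall>i<k. \<alpha> ((omega ^^ i) u) = \<alpha> ((omega ^^ i) v))"

lemma agree_Suc: "agree (Suc k) u v \<longleftrightarrow> \<alpha> u = \<alpha> v \<and> agree k (omega u) (omega v)"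
  unfolding agree_def by (simp add: All_less_Suc2 funpow_swap1)

text \<open>The definition of \<open>r1\<close> bounds the common prefix by the lengths of both normal forms. If padded
  entries agree beyond the end of the shorter form, the longer one has a \<open>1\<close> there,
  which is impossible; so the forms coincide.\<close>
lemma r1_ge_iff:
  assumes u: "u \<in> carrier M" and v: "v \<in> carrier M"
  shows "enat k \<le> r1 S m u v \<longleftrightarrow> agree k u v"
proof (cases "u = v")
  case True
  then show ?thesis by (simp add: r1_def agree_def)
next
  case False
  define us vs where "us = normal_form S m u" and "vs = normal_form S m v"
  have nf: "is_nf u us" "is_nf v vs"
    unfolding us_def vs_def using is_nf_normal_form u v by auto
  note nth = is_nf_nth[OF u nf(1)] is_nf_nth[OF v nf(2)]
  have ne: "us ! i \<noteq> \<one>\<^bsub>M\<^esub>" if "i < length us" for i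
    using nf(1) nth_mem[OF that] unfolding is_nf_def by blast
  have ne': "vs ! i \<noteq> \<one>\<^bsub>M\<^esub>" if "i < length vs" for i
    using nf(2) nth_mem[OF that] unfolding is_nf_def by blast
  define K where "K = {k. k \<le> min (length us) (length vs) \<and> (\<forall>i<k. us ! i = vs ! i)}"
  have "finite K" "0 \<in> K" unfolding K_def by simp_all
  then have MK: "Max K \<in> K" "\<And>j. j \<in> K \<Longrightarrow> j \<le> Max K"
    using Max_in[of K] Max_ge[of K] by blast+
  have "k \<in> K \<longleftrightarrow> k \<le> Max K"
  proof
    assume "k \<le> Max K"
    then show "k \<in> K" using MK(1) unfolding K_def by auto
  qed (rule MK(2))
  moreover have "k \<in> K \<longleftrightarrow> agree k u v"
  proof
    assume "k \<in> K"
    then show "agree k u v" unfolding K_def agree_def nth by auto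
  next
    assume ag: "agree k u v"
    then have eq: "(if i < length us then us ! i else \<one>\<^bsub>M\<^esub>) = (if i < length vs then vs ! i else \<one>\<^bsub>M\<^esub>)"
      if "i < k" for i
      using that unfolding agree_def nth by blast
    have "k \<le> min (length us) (length vs)"
    proof (rule ccontr)
      assume short: "\<not> k \<le> min (length us) (length vs)"
      have "length us = length vs"
      proof (rule ccontr)
        assume "length us \<noteq> length vs"
        then consider "length us < length vs" "length us < k" | "length vs < length us" "length vs < k"
          using short by linarith
        then show False
        proof cases
          case 1
          then show False using eq[of "length us"] ne'[of "length us"] by simp
        next
          case 2
          then show False using eq[of "length vs"] ne[of "length vs"] by simp
        qed
      qed
      moreover have "us ! i = vs ! i" if "i < length us" for i
        using eq[of i] short that calculation by simp
      ultimately have "us = vs" by (rule nth_equalityI)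
      then show False using nf False by (simp add: is_nf_def)
    qed
    moreover have "us ! i = vs ! i" if "i < k" for i
      using eq[OF that] calculation that by simp
    ultimately show "k \<in> K" unfolding K_def by blast
  qed
  moreover have "r1 S m u v = enat (Max K)"
    using False by (simp add: r1_def Let_def K_def us_def vs_def)
  ultimately show ?thesis by simp
qed

lemma d1_le_iff: "d1 S m u v \<le> d1 S m u' v' \<longleftrightarrow> r1 S m u' v' \<le> r1 S m u v"
  by (cases "r1 S m u v"; cases "r1 S m u' v'") (auto simp: d1_def frac_le divide_simps not_le)

lemma contraction_iff_agree:
  assumes closed: "\<And>u. u \<in> carrier M \<Longrightarrow> f u \<in> carrier M"
  shows "contraction_on (carrier M) (d1 S m) f \<longleftrightarrow>
    (\<forall>u\<in>carrier M. \<forall>v\<in>carrier M. \<forall>k. agree k u v \<longrightarrow> agree k (f u) (f v))"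
proof -
  have le_iff: "a \<le> b \<longleftrightarrow> (\<forall>k. enat k \<le> a \<longrightarrow> enat k \<le> b)" for a b :: enat
  proof (cases b)
    case (enat n)
    have "a \<le> b" if "\<forall>k. enat k \<le> a \<longrightarrow> enat k \<le> b"
      using that[rule_format, of "Suc n"] enat by (auto simp: Suc_ile_eq not_le[symmetric])
    then show ?thesis using order.trans by blast
  qed simp
  show ?thesis
    unfolding contraction_on_def d1_le_iff
  proof (rule ball_cong[OF HOL.refl], rule ball_cong[OF HOL.refl])
    fix u v assume uv: "u \<in> carrier M" "v \<in> carrier M"
    show "r1 S m u v \<le> r1 S m (f u) (f v) \<longleftrightarrow> (\<forall>k. agree k u v \<longrightarrow> agree k (f u) (f v))"
      unfolding le_iff[of "r1 S m u v"] r1_ge_iff[OF uv] r1_ge_iff[OF closed closed, OF uv] ..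
  qed
qed

section \<open>Endomorphisms and agreement of normal forms\<close>

text \<open>With \<open>u = a r\<close> and \<open>a = \<alpha>(u)\<close>, the pair \<open>a, \<alpha>(r)\<close> satisfies the hypothesis of (ii), and by induction
  \<open>\<phi>(r)\<close> may be replaced by \<open>\<phi>(\<alpha>(r))\<close> inside \<open>\<alpha>\<close>.\<close>
lemma alpha_map_alpha:
  assumes hom: "f \<in> hom M M" and one: "f \<one>\<^bsub>M\<^esub> = \<one>\<^bsub>M\<^esub>"
    and ii: "\<And>u v. u \<in> Red \<Longrightarrow> v \<in> Red \<Longrightarrow> \<alpha> (u \<otimes>\<^bsub>M\<^esub> v) = u \<Longrightarrow> \<alpha> (f (u \<otimes>\<^bsub>M\<^esub> v)) = \<alpha> (f u)"
  shows "u \<in> carrier M \<Longrightarrow> \<alpha> (f u) = \<alpha> (f (\<alpha> u))"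
proof (induction "artin_length u" arbitrary: u rule: less_induct)
  case less
  note u = less.prems
  have fc: "f x \<in> carrier M" if "x \<in> carrier M" for x using hom that by (rule hom_in_carrier)
  have fm: "f (x \<otimes>\<^bsub>M\<^esub> y) = f x \<otimes>\<^bsub>M\<^esub> f y" if "x \<in> carrier M" "y \<in> carrier M" for x y
    using hom that by (rule hom_mult)
  show ?case
  proof (cases "u = \<one>\<^bsub>M\<^esub>")
    case True
    then show ?thesis by (simp add: alpha_one)
  next
    case False
    define a r where "a = \<alpha> u" and "r = omega u"
    have ar: "a \<in> carrier M" "r \<in> carrier M" "u = a \<otimes>\<^bsub>M\<^esub> r"
      unfolding a_def r_def using u omega_carrier alpha_omega by simp_all
    have IH: "\<alpha> (f r) = \<alpha> (f (\<alpha> r))" using less.hyps[OF _ ar(2)] omega_length[OF u False] r_def by simp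
    have aR: "a \<in> Red" unfolding a_def by (rule alpha_Red[OF u])
    have "\<alpha> (a \<otimes>\<^bsub>M\<^esub> \<alpha> r) = a" using alpha_mult[OF ar(1,2)] ar(3) a_def by metis
    then have fa: "\<alpha> (f (a \<otimes>\<^bsub>M\<^esub> \<alpha> r)) = \<alpha> (f a)" by (rule ii[OF aR alpha_Red[OF ar(2)]])
    have "\<alpha> (f u) = \<alpha> (f a \<otimes>\<^bsub>M\<^esub> f r)" using fm[OF ar(1,2)] ar(3) by metis
    also have "\<dots> = \<alpha> (f a \<otimes>\<^bsub>M\<^esub> \<alpha> (f (\<alpha> r)))"
      unfolding alpha_mult[OF fc[OF ar(1)] fc[OF ar(2)]] IH ..
    also have "\<dots> = \<alpha> (f a \<otimes>\<^bsub>M\<^esub> f (\<alpha> r))"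
      using alpha_mult[OF fc[OF ar(1)] fc[OF alpha_carrier[OF ar(2)]]] by (rule HOL.sym)
    also have "\<dots> = \<alpha> (f (a \<otimes>\<^bsub>M\<^esub> \<alpha> r))"
      unfolding fm[OF ar(1) alpha_carrier[OF ar(2)]] ..
    also note fa
    finally show ?thesis unfolding a_def .
  qed
qed

text \<open>The factor \<open>z\<close> is what remains of the image of earlier entries after their part of the normal form has
  been removed. It has to be arbitrary for the induction.\<close>
lemma agree_map:
  assumes hom: "f \<in> hom M M" and fa: "\<And>u. u \<in> carrier M \<Longrightarrow> \<alpha> (f u) = \<alpha> (f (\<alpha> u))"
  shows "z \<in> carrier M \<Longrightarrow> u \<in> carrier M \<Longrightarrow> v \<in> carrier M \<Longrightarrow> agree k u v \<Longrightarrow>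
    agree k (z \<otimes>\<^bsub>M\<^esub> f u) (z \<otimes>\<^bsub>M\<^esub> f v)"
proof (induction k arbitrary: z u v)
  case 0
  then show ?case by (simp add: agree_def)
next
  case (Suc k)
  note z = Suc.prems(1)
  have fc: "f x \<in> carrier M" if "x \<in> carrier M" for x using hom that by (rule hom_in_carrier)
  have step: "\<alpha> (z \<otimes>\<^bsub>M\<^esub> f x) = \<alpha> (z \<otimes>\<^bsub>M\<^esub> f (\<alpha> x))"
    "omega (z \<otimes>\<^bsub>M\<^esub> f x) = omega (z \<otimes>\<^bsub>M\<^esub> f (\<alpha> x)) \<otimes>\<^bsub>M\<^esub> f (omega x)" if x: "x \<in> carrier M" for x
  proof -
    have a: "\<alpha> x \<in> carrier M" and o: "omega x \<in> carrier M" using x omega_carrier by simp_all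
    show alpha_eq: "\<alpha> (z \<otimes>\<^bsub>M\<^esub> f x) = \<alpha> (z \<otimes>\<^bsub>M\<^esub> f (\<alpha> x))"
      using alpha_mult[OF z fc[OF x]] alpha_mult[OF z fc[OF a]] fa[OF x] by simp
    let ?y = "z \<otimes>\<^bsub>M\<^esub> f (\<alpha> x)"
    have y: "?y \<in> carrier M" using z fc[OF a] by simp
    have "f x = f (\<alpha> x) \<otimes>\<^bsub>M\<^esub> f (omega x)" using hom_mult[OF hom a o] alpha_omega[OF x] by simp
    then have "z \<otimes>\<^bsub>M\<^esub> f x = ?y \<otimes>\<^bsub>M\<^esub> f (omega x)" using M.m_assoc[OF z fc[OF a] fc[OF o]] by simp
    also have "\<dots> = \<alpha> ?y \<otimes>\<^bsub>M\<^esub> omega ?y \<otimes>\<^bsub>M\<^esub> f (omega x)" using alpha_omega[OF y] by simp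
    also have "\<dots> = \<alpha> (z \<otimes>\<^bsub>M\<^esub> f x) \<otimes>\<^bsub>M\<^esub> (omega ?y \<otimes>\<^bsub>M\<^esub> f (omega x))"
      using M.m_assoc[OF alpha_carrier[OF y] omega_carrier[OF y] fc[OF o]] alpha_eq by simp
    finally show "omega (z \<otimes>\<^bsub>M\<^esub> f x) = omega ?y \<otimes>\<^bsub>M\<^esub> f (omega x)"
      using omega_eqI z fc[OF x] fc[OF o] omega_carrier[OF y] by simp
  qed
  have e: "\<alpha> u = \<alpha> v" "agree k (omega u) (omega v)" using Suc.prems(4) agree_Suc by auto
  have "z \<otimes>\<^bsub>M\<^esub> f (\<alpha> v) \<in> carrier M" using z fc Suc.prems(3) by simp
  then have "agree k (omega (z \<otimes>\<^bsub>M\<^esub> f (\<alpha> v)) \<otimes>\<^bsub>M\<^esub> f (omega u)) (omega (z \<otimes>\<^bsub>M\<^esub> f (\<alpha> v)) \<otimes>\<^bsub>M\<^esub> f (omega v))"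
    using Suc.IH omega_carrier Suc.prems(2,3) e(2) by simp
  then show ?case
    unfolding agree_Suc step[OF Suc.prems(2)] step[OF Suc.prems(3)] e(1) by simp
qed

end

theorem theorem0p2:
  fixes S :: "'a set" and m :: "'a \<Rightarrow> 'a \<Rightarrow> enat" and \<phi> :: "'a list set \<Rightarrow> 'a list set"
  assumes "coxeter_matrix S m"
    and "\<phi> \<in> monoid_End (artin_monoid S m)"
  shows "contraction_on (carrier (artin_monoid S m)) (d1 S m) \<phi> \<longleftrightarrow>
    (\<forall>u\<in>M_red S m. \<forall>v\<in>M_red S m.
       alpha S m (u \<otimes>\<^bsub>artin_monoid S m\<^esub> v) = u \<longrightarrow>
       alpha S m (\<phi> (u \<otimes>\<^bsub>artin_monoid S m\<^esub> v)) = alpha S m (\<phi> u))"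
proof -
  interpret coxeter_matrix S m by fact
  have hom: "\<phi> \<in> hom M M" and one: "\<phi> \<one>\<^bsub>M\<^esub> = \<one>\<^bsub>M\<^esub>"
    using assms(2) by (simp_all add: monoid_End_def)
  have fc: "\<phi> x \<in> carrier M" if "x \<in> carrier M" for x using hom that by (rule hom_in_carrier)
  have iff: "contraction_on (carrier M) (d1 S m) \<phi> \<longleftrightarrow>
      (\<forall>u\<in>carrier M. \<forall>v\<in>carrier M. \<forall>k. agree k u v \<longrightarrow> agree k (\<phi> u) (\<phi> v))"
    by (rule contraction_iff_agree) (rule fc)
  show ?thesis
    unfolding iff
  proof (intro iffI ballI allI impI)
    fix u v
    assume contr: "\<forall>u\<in>carrier M. \<forall>v\<in>carrier M. \<forall>k. agree k u v \<longrightarrow> agree k (\<phi> u) (\<phi> v)"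
      and uv: "u \<in> Red" "v \<in> Red" "\<alpha> (u \<otimes>\<^bsub>M\<^esub> v) = u"
    have "agree 1 (u \<otimes>\<^bsub>M\<^esub> v) u" using uv alpha_of_Red by (simp add: agree_def)
    then have "agree 1 (\<phi> (u \<otimes>\<^bsub>M\<^esub> v)) (\<phi> u)" using contr uv Red_carrier by simp
    then show "\<alpha> (\<phi> (u \<otimes>\<^bsub>M\<^esub> v)) = \<alpha> (\<phi> u)" by (simp add: agree_def)
  next
    fix u v k
    assume ii: "\<forall>u\<in>Red. \<forall>v\<in>Red. \<alpha> (u \<otimes>\<^bsub>M\<^esub> v) = u \<longrightarrow> \<alpha> (\<phi> (u \<otimes>\<^bsub>M\<^esub> v)) = \<alpha> (\<phi> u)"
      and uv: "u \<in> carrier M" "v \<in> carrier M" "agree k u v"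
    have "\<alpha> (\<phi> x) = \<alpha> (\<phi> (\<alpha> x))" if "x \<in> carrier M" for x
      using alpha_map_alpha[OF hom one] ii that by blast
    then have "agree k (\<one>\<^bsub>M\<^esub> \<otimes>\<^bsub>M\<^esub> \<phi> u) (\<one>\<^bsub>M\<^esub> \<otimes>\<^bsub>M\<^esub> \<phi> v)"
      using agree_map[OF hom _ _ uv] by simp
    then show "agree k (\<phi> u) (\<phi> v)" using fc uv by simp
  qed
qed

end
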